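(* Let $\Omega\subset\mathbb{R}^N$ be a bounded open connected set, $F\in C(\Omega\times\mathbb{R}\times\mathcal{S}(N),\mathbb{R})$, and let $\Phi$ be either a Hausdorff continuous proper elliptic map on $\Omega$ (constrained case) or $\Phi(x)=\mathcal{J}:=\mathbb{R}\times\mathcal{S}(N)$ for all $x\in\Omega$ (unconstrained case). Let $\Theta(x):=\{(r,A)\in\Phi(x):F(x,r,A)\ge0\}$ and $\Gamma(x):=\{(r,A):F(x,r,A)=0\}$. Assume: (i) $F(x,r+s,A+P)\ge F(x,r,A)$ for all $x\in\Omega$, $(r,A)\in\Phi(x)$, $(s,P)\in\mathcal{Q}$; (ii) for every open $\Omega'\subset\subset\Omega$ and every $\eta>0$ there is $\delta=\delta(\eta,\Omega')>0$ with $F(y,r-\eta,A+\eta I)\ge F(x,r,A)$ for all $(r,A)\in\Phi(x)$ and all $x,y\in\Omega'$ with $|x-y|<\delta$; (iii) $\Gamma(x)\cap\Phi(x)\neq\emptyset$ for each $x\in\Omega$; (iv) $F(x,r,A)>0$ for each $x\in\Omega$ and each $(r,A)\in(\Theta(x))^\circ$. In the constrained case assume moreover (v) $\partial\Phi(x)\subset\{(r,A):F(x,r,A)\le0\}$ for each $x$, and in the unconstrained case assume (v') $\{(r,A)\in\mathcal J:F(x,r,A)<0\}\neq\emptyset$ for every $x\in\Omega$. Then $\Theta$ is a Hausdorff continuous proper elliptic map, $\partial\Theta(x)\subset\Gamma(x)$ for all $x\in\Omega$, and the comparison principle holds: if $u\in\mathrm{USC}(\overline\Omega)$ restricts to a $\Phi$-admissible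 viscosity subsolution of $F(x,u,D^2u)=0$ in $\Omega$, $v\in\mathrm{LSC}(\overline\Omega)$ restricts to a $\Phi$-admissible viscosity supersolution of the same equation in $\Omega$, and $u\le v$ on $\partial\Omega$, then $u\le v$ in $\Omega$.
   Context: $\mathcal{S}(N)$: real symmetric $N\times N$ matrices with usual partial order, eigenvalues $\lambda_i(A)$, identity $I$. $\mathcal{Q}:=\{(s,P): s\le0,\ P\ge0\}$. A proper elliptic map assigns to each $x\in\Omega$ a closed, nonempty set $\subsetneq\mathbb{R}\times\mathcal{S}(N)$ invariant under adding elements of $\mathcal Q$. Hausdorff continuity: with norm $\|(r,A)\|=\max\{|r|,\max_i|\lambda_i(A)|\}$ and the induced Hausdorff distance $d_{\mathcal H}$ on closed subsets (possibly $+\infty$), for all $x\in\Omega$, $\eta>0$ there is $\delta>0$ with $d_{\mathcal H}(\Theta(x),\Theta(y))<\eta$ for $y\in\Omega$, $|x-y|<\delta$. $J^+_{x_0}u:=\{(\varphi(x_0),D^2\varphi(x_0)):\varphi$ is $C^2$ near $x_0$, $u\le\varphi$ near $x_0$, $u(x_0)=\varphi(x_0)\}$, $J^-_{x_0}u$ likewise with $u\ge\varphi$. $u\in\mathrm{USC}(\Omega)$ is a $\Phi$-admissible viscosity subsolution if for all $x_0\in\Omega$ and $(r,A)\in J^+_{x_0}u$: $F(x_0,r,A)\ge0$ and $(r,A)\in\Phi(x_0)$. $v\in\mathrm{LSC}(\Omega)$ is a $\Phi$-admissible viscosity supersolution if for all $x_0$ and $(r,A)\in J^-_{x_0}v$: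 $F(x_0,r,A)\le0$ or $(r,A)\notin(\Phi(x_0))^\circ$. *)

theory Defs
  imports "HOL-Analysis.Analysis"
begin

definition symm_mats :: "(real^'n^'n) set" where
  "symm_mats = {A. transpose A = A}"

(* usual partial order on S(N): A <= B iff B - A is positive semidefinite *)
definition psd :: "real^'n^'n \<Rightarrow> bool" where
  "psd P \<longleftrightarrow> transpose P = P \<and> (\<forall>\<xi>. 0 \<le> \<xi> \<bullet> (P *v \<xi>))"

definition eigvals :: "real^'n^'n \<Rightarrow> real set" where
  "eigvals A = {l. \<exists>v. v \<noteq> 0 \<and> A *v v = l *\<^sub>R v}"

definition eig_norm :: "real^'n^'n \<Rightarrow> real" where
  "eig_norm A = Max ((\<lambda>l. \<bar>l\<bar>) ` eigvals A)"

definition Jspace :: "(real \<times> (real^'n^'n)) set" where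
  "Jspace = UNIV \<times> symm_mats"

definition jnorm :: "real \<times> (real^'n^'n) \<Rightarrow> real" where
  "jnorm p = max \<bar>fst p\<bar> (eig_norm (snd p))"

definition Qcone :: "(real \<times> (real^'n^'n)) set" where
  "Qcone = {(s, P). s \<le> 0 \<and> psd P}"

definition int_J :: "(real \<times> (real^'n^'n)) set \<Rightarrow> (real \<times> (real^'n^'n)) set" where
  "int_J S = {p \<in> S. \<exists>e>0. \<forall>q\<in>Jspace. jnorm (q - p) < e \<longrightarrow> q \<in> S}"

definition closure_J :: "(real \<times> (real^'n^'n)) set \<Rightarrow> (real \<times> (real^'n^'n)) set" where
  "closure_J S = {p \<in> Jspace. \<forall>e>0. \<exists>q\<in>S. jnorm (q - p) < e}"

definition closed_J :: "(real \<times> (real^'n^'n)) set \<Rightarrow> bool" where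
  "closed_J S \<longleftrightarrow> S \<subseteq> Jspace \<and> closure_J S \<subseteq> S"

definition bdry_J :: "(real \<times> (real^'n^'n)) set \<Rightarrow> (real \<times> (real^'n^'n)) set" where
  "bdry_J S = closure_J S - int_J S"

definition hdist_J :: "(real \<times> (real^'n^'n)) set \<Rightarrow> (real \<times> (real^'n^'n)) set \<Rightarrow> ereal" where
  "hdist_J S T = max (SUP s\<in>S. INF t\<in>T. ereal (jnorm (s - t)))
                     (SUP t\<in>T. INF s\<in>S. ereal (jnorm (t - s)))"

definition proper_elliptic_map ::
  "(real^'n) set \<Rightarrow> (real^'n \<Rightarrow> (real \<times> (real^'n^'n)) set) \<Rightarrow> bool" where
  "proper_elliptic_map \<Omega> \<Phi> \<longleftrightarrow>
     (\<forall>x\<in>\<Omega>. closed_J (\<Phi> x) \<and> \<Phi> x \<noteq> {} \<and> \<Phi> x \<noteq> Jspace \<and>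
        (\<forall>p\<in>\<Phi> x. \<forall>q\<in>Qcone. p + q \<in> \<Phi> x))"

definition hausdorff_continuous ::
  "(real^'n) set \<Rightarrow> (real^'n \<Rightarrow> (real \<times> (real^'n^'n)) set) \<Rightarrow> bool" where
  "hausdorff_continuous \<Omega> \<Theta> \<longleftrightarrow>
     (\<forall>x\<in>\<Omega>. \<forall>\<eta>>0. \<exists>\<delta>>0. \<forall>y\<in>\<Omega>. dist x y < \<delta> \<longrightarrow> hdist_J (\<Theta> x) (\<Theta> y) < ereal \<eta>)"

definition usc_on :: "(real^'n) set \<Rightarrow> (real^'n \<Rightarrow> real) \<Rightarrow> bool" where
  "usc_on S u \<longleftrightarrow> (\<forall>x\<in>S. \<forall>a. u x < a \<longrightarrow> (\<exists>e>0. \<forall>y\<in>S. dist y x < e \<longrightarrow> u y < a))"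

definition lsc_on :: "(real^'n) set \<Rightarrow> (real^'n \<Rightarrow> real) \<Rightarrow> bool" where
  "lsc_on S u \<longleftrightarrow> (\<forall>x\<in>S. \<forall>a. a < u x \<longrightarrow> (\<exists>e>0. \<forall>y\<in>S. dist y x < e \<longrightarrow> a < u y))"

definition C2_on_with :: "(real^'n) set \<Rightarrow> (real^'n \<Rightarrow> real) \<Rightarrow> (real^'n \<Rightarrow> real^'n)
     \<Rightarrow> (real^'n \<Rightarrow> real^'n^'n) \<Rightarrow> bool" where
  "C2_on_with U \<phi> g H \<longleftrightarrow> open U \<and>
     (\<forall>x\<in>U. (\<phi> has_derivative (\<lambda>h. g x \<bullet> h)) (at x)) \<and>
     (\<forall>x\<in>U. (g has_derivative (\<lambda>h. H x *v h)) (at x)) \<and>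
     continuous_on U H"

definition jet_plus :: "(real^'n \<Rightarrow> real) \<Rightarrow> real^'n \<Rightarrow> (real \<times> (real^'n^'n)) set" where
  "jet_plus u x0 = {(\<phi> x0, H x0) | \<phi> g H U. x0 \<in> U \<and> C2_on_with U \<phi> g H \<and>
       (\<forall>x\<in>U. u x \<le> \<phi> x) \<and> u x0 = \<phi> x0}"

definition jet_minus :: "(real^'n \<Rightarrow> real) \<Rightarrow> real^'n \<Rightarrow> (real \<times> (real^'n^'n)) set" where
  "jet_minus u x0 = {(\<phi> x0, H x0) | \<phi> g H U. x0 \<in> U \<and> C2_on_with U \<phi> g H \<and>
       (\<forall>x\<in>U. u x \<ge> \<phi> x) \<and> u x0 = \<phi> x0}"

definition adm_subsolution ::
  "(real^'n \<Rightarrow> real \<Rightarrow> real^'n^'n \<Rightarrow> real) \<Rightarrow> (real^'n \<Rightarrow> (real \<times> (real^'n^'n)) set)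
    \<Rightarrow> (real^'n) set \<Rightarrow> (real^'n \<Rightarrow> real) \<Rightarrow> bool" where
  "adm_subsolution F \<Phi> \<Omega> u \<longleftrightarrow> usc_on \<Omega> u \<and>
     (\<forall>x0\<in>\<Omega>. \<forall>(r, A)\<in>jet_plus u x0. F x0 r A \<ge> 0 \<and> (r, A) \<in> \<Phi> x0)"

definition adm_supersolution ::
  "(real^'n \<Rightarrow> real \<Rightarrow> real^'n^'n \<Rightarrow> real) \<Rightarrow> (real^'n \<Rightarrow> (real \<times> (real^'n^'n)) set)
    \<Rightarrow> (real^'n) set \<Rightarrow> (real^'n \<Rightarrow> real) \<Rightarrow> bool" where
  "adm_supersolution F \<Phi> \<Omega> v \<longleftrightarrow> lsc_on \<Omega> v \<and>
     (\<forall>x0\<in>\<Omega>. \<forall>(r, A)\<in>jet_minus v x0. F x0 r A \<le> 0 \<or> (r, A) \<notin> int_J (\<Phi> x0))"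

end

theory Submission
  imports Defs
begin

text \<open>
  Sets invariant under \<open>Qcone\<close> are governed by shifts along \<open>(-e, e I)\<close>, which reduces the claims on \<open>\<Theta>\<close> to the
  monotonicity and regularity of \<open>F\<close> along this direction.

  For the comparison principle, suppose that \<open>u - v\<close> is positive somewhere. After adding a small strictly convex
  quadratic to \<open>u\<close>, the sup-convolution of \<open>u\<close> and the inf-convolution of \<open>v\<close> are touched everywhere from one side by
  paraboloids, and their difference \<open>W\<close> still has a positive maximum. The points where \<open>W\<close> is touched from above by an
  affine function of small slope form a set of positive measure, because the slope is a Lipschitz function of the
  touching point and attains every small value. On this set the first convolution is touched from both sides, so
  its gradient is Lipschitz there, and by Rademacher's theorem together with the density theorem it has a
  second-order expansion at one of its points. The second convolution inherits the same Hessian as a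
  subjet, so only one function has to be twice differentiable. Translating the two jets to nearby
  points of the domain and using the Hausdorff continuity of \<open>\<Theta>\<close> contradicts that \<open>v\<close> is a supersolution.
\<close>

section \<open>Rademacher's theorem\<close>

lemma negligible_iff_outer_measure_0:
  "negligible S \<longleftrightarrow> outer_measure_of lebesgue S = 0"
proof
  assume "negligible S"
  then show "outer_measure_of lebesgue S = 0"
    by (simp add: negligible_iff_null_sets null_sets_def)
next
  assume 0: "outer_measure_of lebesgue S = 0"
  obtain E where "E \<in> sets lebesgue" "S \<subseteq> E" "outer_measure_of lebesgue S = emeasure lebesgue E"
    using outer_measure_of_attain[of S lebesgue] by auto
  with 0 have "negligible E"
    by (simp add: negligible_iff_null_sets null_sets_def)
  then show "negligible S"
    using \<open>S \<subseteq> E\<close> negligible_subset by blast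
qed

lemma outer_measure_of_bounded_finite:
  fixes S :: "'a::euclidean_space set"
  assumes "bounded S"
  shows "outer_measure_of lebesgue S < \<infinity>"
proof -
  obtain r where "S \<subseteq> cball 0 r"
    using bounded_subset_ballD[OF assms, of 0] ball_subset_cball by blast
  then have "outer_measure_of lebesgue S \<le> outer_measure_of lebesgue (cball (0::'a) r)"
    by (rule outer_measure_of_mono)
  also have "\<dots> = emeasure lborel (cball (0::'a) r)"
    by simp
  also have "\<dots> < \<infinity>"
    by (rule emeasure_bounded_finite) simp
  finally show ?thesis .
qed

lemma outer_measure_of_Vitali_image_le:
  fixes f :: "'a::euclidean_space \<Rightarrow> 'a"
  assumes k: "0 < k"
    and lip: "\<And>x y. x \<in> S \<Longrightarrow> y \<in> S \<Longrightarrow> norm (f y - f x) \<le> B * norm (y - x)"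
    and cov: "\<And>x d. x \<in> S \<Longrightarrow> 0 < d \<Longrightarrow>
      \<exists>c r T. 0 < r \<and> r < d \<and> x \<in> cball c r \<and> f ` (S \<inter> cball c r) \<subseteq> T \<and>
        T \<in> sets lebesgue \<and> emeasure lebesgue T \<le> ennreal k * emeasure lebesgue (cball c r)"
  shows "outer_measure_of lebesgue (f ` S) \<le> ennreal k * outer_measure_of lebesgue S"
proof -
  let ?\<mu> = "emeasure (lebesgue :: 'a measure)"
  note emeasure_completion [simp del]
  have open_bound: "outer_measure_of lebesgue (f ` S) \<le> ennreal k * ?\<mu> U"
    if U: "open U" "S \<subseteq> U" for U
  proof -
    define good where "good i T \<longleftrightarrow> f ` (S \<inter> cball (fst i) (snd i)) \<subseteq> T \<and> T \<in> sets lebesgue \<and>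
      ?\<mu> T \<le> ennreal k * ?\<mu> (cball (fst i) (snd i))" for i :: "'a \<times> real" and T
    define K where "K = {i :: 'a \<times> real. 0 < snd i \<and> cball (fst i) (snd i) \<subseteq> U \<and> (\<exists>T. good i T)}"
    have fine: "\<exists>i. i \<in> K \<and> x \<in> cball (fst i) (snd i) \<and> snd i < d" if xd: "x \<in> S" "0 < d" for x d
    proof -
      obtain e where e: "0 < e" "ball x e \<subseteq> U"
        using U(1) subsetD[OF U(2) xd(1)] open_contains_ball_eq by blast
      obtain c r T where *: "0 < r" "r < min d (e/3)" "x \<in> cball c r" "f ` (S \<inter> cball c r) \<subseteq> T"
        "T \<in> sets lebesgue" "?\<mu> T \<le> ennreal k * ?\<mu> (cball c r)"
        using cov[OF \<open>x \<in> S\<close>, of "min d (e/3)"] xd e by auto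
      have "cball c r \<subseteq> ball x e"
      proof
        fix y assume y: "y \<in> cball c r"
        have "dist x y \<le> dist x c + dist c y" by (rule dist_triangle)
        with y * show "y \<in> ball x e" by (auto simp: dist_commute)
      qed
      with * e have "(c, r) \<in> K"
        unfolding K_def good_def by auto
      with * show ?thesis by (intro exI[of _ "(c, r)"]) auto
    qed
    obtain C where C: "countable C" "C \<subseteq> K"
      "pairwise (\<lambda>i j. disjnt (cball (fst i) (snd i)) (cball (fst j) (snd j))) C"
      and neg: "negligible (S - (\<Union>i\<in>C. cball (fst i) (snd i)))"
      by (rule Vitali_covering_theorem_cballs[of K snd S fst])
         (use fine in \<open>auto simp: K_def\<close>)
    obtain T where T: "\<And>i. i \<in> K \<Longrightarrow> good i (T i)"
      using bchoice[of K good] unfolding K_def by blast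
    define I where "I = to_nat_on C ` C"
    have inv: "from_nat_into C (to_nat_on C i) = i" if "i \<in> C" for i
      using that C by simp
    define A where "A n = (if n \<in> I then T (from_nat_into C n) else {})" for n
    define Q where "Q n = (if n \<in> I then cball (fst (from_nat_into C n)) (snd (from_nat_into C n)) else {})" for n
    have goodA: "good i (T i)" if "i \<in> C" for i
      using T[OF subsetD[OF C(2) that]] .
    have setsA: "range A \<subseteq> sets lebesgue"
      unfolding A_def I_def using goodA inv by (auto simp: good_def)
    have setsQ: "range Q \<subseteq> sets lebesgue"
      unfolding Q_def by auto
    have AQ: "?\<mu> (A n) \<le> ennreal k * ?\<mu> (Q n)" for n
      unfolding A_def Q_def I_def using goodA inv by (auto simp: good_def)
    have disj: "disjoint_family Q"
      unfolding disjoint_family_on_def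
    proof (intro ballI impI)
      fix m n :: nat assume "m \<noteq> n"
      show "Q m \<inter> Q n = {}"
      proof (cases "m \<in> I \<and> n \<in> I")
        case True
        then obtain i j where ij: "i \<in> C" "j \<in> C" "m = to_nat_on C i" "n = to_nat_on C j"
          unfolding I_def by auto
        with \<open>m \<noteq> n\<close> have "i \<noteq> j" by auto
        then have "cball (fst i) (snd i) \<inter> cball (fst j) (snd j) = {}"
          using C(3) ij by (auto simp: pairwise_def disjnt_def)
        then show ?thesis
          using True ij inv by (simp add: Q_def)
      qed (auto simp: Q_def)
    qed
    have "(\<Union>n. Q n) \<subseteq> U"
      unfolding Q_def I_def using C inv by (auto simp: K_def split: if_splits)
    then have QU: "?\<mu> (\<Union>n. Q n) \<le> ?\<mu> U"
      using U by (intro emeasure_mono) auto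
    define N where "N = f ` (S - (\<Union>i\<in>C. cball (fst i) (snd i)))"
    have "negligible N"
      unfolding N_def
      by (rule negligible_locally_Lipschitz_image[OF _ neg])
         (auto intro!: exI[of _ UNIV] exI[of _ B] lip)
    then have N: "N \<in> sets lebesgue" "?\<mu> N = 0"
      by (auto simp: negligible_iff_null_sets null_sets_def)
    have UA: "(\<Union>n. A n) \<in> sets lebesgue"
      using setsA by auto
    have "f ` S \<subseteq> N \<union> (\<Union>n. A n)"
    proof
      fix y assume "y \<in> f ` S"
      then obtain x where x: "x \<in> S" "y = f x" by auto
      show "y \<in> N \<union> (\<Union>n. A n)"
      proof (cases "\<exists>i\<in>C. x \<in> cball (fst i) (snd i)")
        case True
        then obtain i where i: "i \<in> C" "x \<in> cball (fst i) (snd i)" by auto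
        with goodA x have "y \<in> T i" unfolding good_def by blast
        then have "y \<in> A (to_nat_on C i)"
          unfolding A_def I_def using i inv by auto
        then show ?thesis by auto
      qed (use x in \<open>auto simp: N_def\<close>)
    qed
    then have "outer_measure_of lebesgue (f ` S) \<le> outer_measure_of lebesgue (N \<union> (\<Union>n. A n))"
      by (rule outer_measure_of_mono)
    also have "\<dots> = ?\<mu> (N \<union> (\<Union>n. A n))"
      using N UA by (intro outer_measure_of_eq) auto
    also have "\<dots> \<le> ?\<mu> N + ?\<mu> (\<Union>n. A n)"
      using N(1) UA by (rule emeasure_subadditive)
    also have "\<dots> = ?\<mu> (\<Union>n. A n)" using N by simp
    also have "\<dots> \<le> (\<Sum>n. ?\<mu> (A n))"
      using setsA by (rule emeasure_subadditive_countably)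
    also have "\<dots> \<le> (\<Sum>n. ennreal k * ?\<mu> (Q n))"
      by (intro suminf_le AQ) auto
    also have "\<dots> = ennreal k * (\<Sum>n. ?\<mu> (Q n))"
      by simp
    also have "(\<Sum>n. ?\<mu> (Q n)) = ?\<mu> (\<Union>n. Q n)"
      using setsQ disj by (rule suminf_emeasure)
    also have "ennreal k * \<dots> \<le> ennreal k * ?\<mu> U"
      using QU by (intro mult_left_mono) auto
    finally show ?thesis .
  qed
  obtain E where E: "E \<in> sets lebesgue" "S \<subseteq> E" "outer_measure_of lebesgue S = ?\<mu> E"
    using outer_measure_of_attain[of S lebesgue] by auto
  show ?thesis
  proof (rule ennreal_le_epsilon)
    fix e :: real assume "0 < e"
    obtain U where U: "open U" "E \<subseteq> U" "U - E \<in> lmeasurable" "?\<mu> (U - E) < ennreal (e / k)"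
      using sets_lebesgue_outer_open[OF E(1), of "e / k"] \<open>0 < e\<close> k by auto
    have "?\<mu> U = ?\<mu> (E \<union> (U - E))"
      using U by (simp add: Un_absorb1)
    also have "\<dots> \<le> ?\<mu> E + ?\<mu> (U - E)"
      using E U by (intro emeasure_subadditive) auto
    also have "\<dots> \<le> ?\<mu> E + ennreal (e / k)"
      using U by (intro add_left_mono) auto
    finally have "ennreal k * ?\<mu> U \<le> ennreal k * (?\<mu> E + ennreal (e / k))"
      by (intro mult_left_mono) auto
    also have "\<dots> = ennreal k * ?\<mu> E + ennreal e"
      using k \<open>0 < e\<close> by (simp add: distrib_left flip: ennreal_mult)
    finally show "outer_measure_of lebesgue (f ` S) \<le> ennreal k * outer_measure_of lebesgue S + ennreal e"
      using open_bound[OF U(1) subset_trans[OF E(2) U(2)]] E(3) by simp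
  qed
qed

definition nonporous_at :: "'a::metric_space set \<Rightarrow> 'a \<Rightarrow> bool" where
  "nonporous_at S x \<longleftrightarrow> (\<forall>e>0. \<exists>d>0. \<forall>z. dist z x < d \<longrightarrow> (\<exists>y\<in>S. dist z y \<le> e * dist z x))"

lemma negligible_not_nonporous_at:
  fixes S :: "'a::euclidean_space set"
  shows "negligible {x \<in> S. \<not> nonporous_at S x}"
proof -
  define P where "P n = {x \<in> S. norm x \<le> real n \<and>
    (\<forall>d>0. \<exists>z. dist z x < d \<and> (\<forall>y\<in>S. dist z x / Suc n < dist z y))}" for n :: nat
  have "negligible (P n)" for n
  proof -
    define c where "c = (1 / (2 * Suc n)) ^ DIM('a)"
    have "(1 / (2 * real (Suc n))) < 1"
      by (simp add: field_simps)
    then have c: "0 < c" "c < 1"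
      unfolding c_def by (auto intro!: power_Suc_less_one simp: power_less_one_iff)
    have *: "outer_measure_of lebesgue ((\<lambda>x. x) ` P n) \<le> ennreal (1 - c) * outer_measure_of lebesgue (P n)"
    proof (rule outer_measure_of_Vitali_image_le[where B = 1])
      fix x d assume x: "x \<in> P n" and d: "0 < (d::real)"
      then obtain z where z: "dist z x < d / 2" "\<And>y. y \<in> S \<Longrightarrow> dist z x / Suc n < dist z y"
        unfolding P_def using half_gt_zero by blast
      define \<rho> where "\<rho> = dist z x"
      have "\<rho> \<noteq> 0"
        using z(2)[of x] x unfolding P_def \<rho>_def by force
      then have \<rho>: "0 < \<rho>" unfolding \<rho>_def by simp
      let ?T = "cball x (2 * \<rho>) - ball z (\<rho> / Suc n)"
      have "ball z (\<rho> / Suc n) \<subseteq> cball x (2 * \<rho>)"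
      proof
        fix y assume "y \<in> ball z (\<rho> / Suc n)"
        moreover have "\<rho> / Suc n \<le> \<rho>" using \<rho> by (simp add: field_simps)
        moreover have "dist x y \<le> dist x z + dist z y" by (rule dist_triangle)
        ultimately show "y \<in> cball x (2 * \<rho>)" by (auto simp: \<rho>_def dist_commute)
      qed
      then have "measure lebesgue ?T = measure lborel (cball x (2 * \<rho>)) - measure lborel (ball z (\<rho> / Suc n))"
        by (subst measure_Diff) (use emeasure_lborel_cball_finite[of x "2 * \<rho>"] in \<open>auto simp: less_top\<close>)
      also have "\<dots> = unit_ball_vol DIM('a) * (2 * \<rho>) ^ DIM('a) - unit_ball_vol DIM('a) * (\<rho> / Suc n) ^ DIM('a)"
        using \<rho> by (simp add: content_cball content_ball)
      also have "(\<rho> / Suc n) ^ DIM('a) = c * (2 * \<rho>) ^ DIM('a)"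
      proof -
        have "\<rho> / Suc n = 1 / (2 * Suc n) * (2 * \<rho>)" by (simp add: field_simps)
        then show ?thesis by (simp only: c_def power_mult_distrib)
      qed
      also have "unit_ball_vol DIM('a) * (2 * \<rho>) ^ DIM('a) - unit_ball_vol DIM('a) * (c * (2 * \<rho>) ^ DIM('a))
        = (1 - c) * measure lborel (cball x (2 * \<rho>))"
        using \<rho> by (simp add: content_cball algebra_simps)
      finally have "emeasure lebesgue ?T = ennreal ((1 - c) * measure lborel (cball x (2 * \<rho>)))"
        by (subst emeasure_eq_measure2) (auto intro!: fmeasurable_Diff)
      also have "\<dots> = ennreal (1 - c) * emeasure lebesgue (cball x (2 * \<rho>))"
        using c by (simp add: ennreal_mult emeasure_eq_measure2)
      finally have "emeasure lebesgue ?T \<le> ennreal (1 - c) * emeasure lebesgue (cball x (2 * \<rho>))"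
        by simp
      moreover have "(\<lambda>x. x) ` (P n \<inter> cball x (2 * \<rho>)) \<subseteq> ?T"
        using z(2) unfolding P_def \<rho>_def by (fastforce simp: not_less)
      ultimately show "\<exists>c' r T. 0 < r \<and> r < d \<and> x \<in> cball c' r \<and> (\<lambda>x. x) ` (P n \<inter> cball c' r) \<subseteq> T \<and>
          T \<in> sets lebesgue \<and> emeasure lebesgue T \<le> ennreal (1 - c) * emeasure lebesgue (cball c' r)"
        using z \<rho> by (intro exI[of _ x] exI[of _ "2 * \<rho>"] exI[of _ ?T]) (auto simp: \<rho>_def)
    qed (use c in auto)
    have "outer_measure_of lebesgue (P n) < \<infinity>"
      by (rule outer_measure_of_bounded_finite) (auto simp: P_def bounded_iff)
    then have "outer_measure_of lebesgue (P n) = 0"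
    proof (cases "outer_measure_of lebesgue (P n)")
      case (real r)
      with * c have "r \<le> (1 - c) * r"
        by (simp flip: ennreal_mult)
      with c real show ?thesis
        by (simp add: algebra_simps mult_le_0_iff)
    qed auto
    then show ?thesis
      by (simp add: negligible_iff_outer_measure_0)
  qed
  then have "negligible (\<Union>n. P n)"
    by (intro negligible_countable_Union) auto
  moreover have "{x \<in> S. \<not> nonporous_at S x} \<subseteq> (\<Union>n. P n)"
  proof
    fix x assume "x \<in> {x \<in> S. \<not> nonporous_at S x}"
    then obtain e where x: "x \<in> S" and e: "0 < e"
      "\<And>d. d > 0 \<Longrightarrow> \<exists>z. dist z x < d \<and> (\<forall>y\<in>S. e * dist z x < dist z y)"
      unfolding nonporous_at_def by (auto simp: not_le)
    obtain n :: nat where n: "max (norm x) (1 / e) < real n"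
      using reals_Archimedean2 by blast
    then have "1 / Suc n \<le> e"
      using e by (auto simp: field_simps)
    then have "dist z x / Suc n \<le> e * dist z x" for z
      using mult_right_mono[of "1 / Suc n" e "dist z x"] by simp
    then have "x \<in> P n"
      unfolding P_def using x n e(2) by simp (meson le_less_trans)
    then show "x \<in> (\<Union>n. P n)" by auto
  qed
  ultimately show ?thesis
    using negligible_subset by blast
qed

lemma dini_real_outer_measure_le:
  fixes f :: "real \<Rightarrow> real"
  assumes q: "0 < q"
    and up: "\<And>x y. x \<le> y \<Longrightarrow> f y - f x \<le> M * (y - x)"
    and low: "\<And>x y. x \<le> y \<Longrightarrow> y - x \<le> f y - f x"
    and S: "\<And>x. x \<in> S \<Longrightarrow> \<exists>\<^sub>F s in at 0. (f (x + s) - f x) / s < q"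
  shows "outer_measure_of lebesgue (f ` S) \<le> ennreal q * outer_measure_of lebesgue S"
proof (rule outer_measure_of_Vitali_image_le[where B = M])
  have mono: "f x \<le> f y" if "x \<le> y" for x y
    using low[OF that] that by linarith
  fix x y assume "x \<in> S" "y \<in> S"
  show "norm (f y - f x) \<le> M * norm (y - x)"
    using up[of x y] up[of y x] mono[of x y] mono[of y x] by (cases "x \<le> y") auto
next
  have mono: "f x \<le> f y" if "x \<le> y" for x y
    using low[OF that] that by linarith
  fix x d :: real assume "x \<in> S" "0 < d"
  then obtain s where s: "s \<noteq> 0" "\<bar>s\<bar> < d" "(f (x + s) - f x) / s < q"
    using S[of x] by (auto simp: frequently_at dist_real_def)
  define a b where "a = min x (x + s)" and "b = max x (x + s)"
  have ab: "a < b" "b - a = \<bar>s\<bar>" "x \<in> {a..b}"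
    using s by (auto simp: a_def b_def)
  have quot: "f b - f a \<le> q * (b - a)"
    using s by (cases "0 < s") (auto simp: a_def b_def min_def max_def field_simps split: if_splits)
  have cb: "cball ((a + b) / 2) ((b - a) / 2) = {a..b}"
    by (auto simp: cball_eq_atLeastAtMost field_simps)
  have "f ` (S \<inter> cball ((a + b) / 2) ((b - a) / 2)) \<subseteq> {f a..f b}"
    unfolding cb using mono by auto
  moreover have "emeasure lebesgue {f a..f b} \<le> ennreal q * emeasure lebesgue (cball ((a + b) / 2) ((b - a) / 2))"
    unfolding cb using quot q ab mono[of a b]
    by (simp add: ennreal_leI flip: ennreal_mult)
  ultimately show "\<exists>c r T. 0 < r \<and> r < d \<and> x \<in> cball c r \<and> f ` (S \<inter> cball c r) \<subseteq> T \<and>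
      T \<in> sets lebesgue \<and> emeasure lebesgue T \<le> ennreal q * emeasure lebesgue (cball c r)"
    using ab(1,3) ab(2)[symmetric] s(2)
    by (rule_tac exI[of _ "(a + b) / 2"], rule_tac exI[of _ "(b - a) / 2"], rule_tac exI[of _ "{f a..f b}"])
      (simp only: cb, simp)
qed (use q in auto)

lemma dini_real_outer_measure_ge:
  fixes f :: "real \<Rightarrow> real"
  assumes q: "0 < q" and M: "0 < M"
    and up: "\<And>x y. x \<le> y \<Longrightarrow> f y - f x \<le> M * (y - x)"
    and low: "\<And>x y. x \<le> y \<Longrightarrow> y - x \<le> f y - f x"
    and S: "\<And>x. x \<in> S \<Longrightarrow> \<exists>\<^sub>F s in at 0. q < (f (x + s) - f x) / s"
  shows "outer_measure_of lebesgue S \<le> ennreal (1 / q) * outer_measure_of lebesgue (f ` S)"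
proof -
  have mono: "f x \<le> f y" if "x \<le> y" for x y
    using low[OF that] that by linarith
  have smono: "f x < f y \<longleftrightarrow> x < y" for x y
    using low[of x y] low[of y x] by (cases "x < y") auto
  have "inj f"
    by (metis injI linorder_neqE smono less_irrefl)
  then have inv: "inv f (f x) = x" for x by simp
  have "outer_measure_of lebesgue (inv f ` (f ` S)) \<le> ennreal (1 / q) * outer_measure_of lebesgue (f ` S)"
  proof (rule outer_measure_of_Vitali_image_le[where B = 1])
    fix u v assume "u \<in> f ` S" "v \<in> f ` S"
    then obtain x y where xy: "u = f x" "v = f y" by auto
    show "norm (inv f v - inv f u) \<le> 1 * norm (v - u)"
      unfolding xy inv using low[of x y] low[of y x] by (cases "x \<le> y") auto
  next
    fix u d :: real assume "u \<in> f ` S" "0 < d"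
    then obtain x where x: "x \<in> S" "u = f x" by auto
    have "0 < d / M" using M \<open>0 < d\<close> by simp
    then obtain s where s: "s \<noteq> 0" "\<bar>s\<bar> < d / M" "q < (f (x + s) - f x) / s"
      using S[OF x(1)] unfolding frequently_at by (auto simp: dist_real_def)
    define a b where "a = min x (x + s)" and "b = max x (x + s)"
    have ab: "a < b" "b - a = \<bar>s\<bar>" "x \<in> {a..b}"
      using s by (auto simp: a_def b_def)
    have quot: "q * (b - a) \<le> f b - f a"
      using s by (cases "0 < s") (auto simp: a_def b_def min_def max_def field_simps split: if_splits)
    have "f b - f a \<le> M * (b - a)" using up[of a b] ab(1) by simp
    also have "\<dots> < d" using s ab M by (simp add: field_simps)
    finally have small: "f b - f a < d" .
    have cb: "cball ((f a + f b) / 2) ((f b - f a) / 2) = {f a..f b}"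
      by (auto simp: cball_eq_atLeastAtMost field_simps)
    have "inv f ` (f ` S \<inter> {f a..f b}) \<subseteq> {a..b}"
      using smono inv by (auto simp flip: not_less)
    moreover have "emeasure lebesgue {a..b} \<le> ennreal (1 / q) * emeasure lebesgue {f a..f b}"
      using quot q ab mono[of a b]
      by (simp add: ennreal_leI field_simps flip: ennreal_mult)
    moreover have "f a < f b" "u \<in> {f a..f b}"
      using ab smono x mono by auto
    ultimately show "\<exists>c r T. 0 < r \<and> r < d \<and> u \<in> cball c r \<and> inv f ` (f ` S \<inter> cball c r) \<subseteq> T \<and>
        T \<in> sets lebesgue \<and> emeasure lebesgue T \<le> ennreal (1 / q) * emeasure lebesgue (cball c r)"
      using small \<open>0 < d\<close>
      by (rule_tac exI[of _ "(f a + f b) / 2"], rule_tac exI[of _ "(f b - f a) / 2"], rule_tac exI[of _ "{a..b}"]) (simp add: cb)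
  qed (use q in auto)
  moreover have "inv f ` (f ` S) = S"
    using \<open>inj f\<close> by (rule image_inv_f_f)
  ultimately show ?thesis by simp
qed

lemma negligible_dini_gap_real:
  fixes g :: "real \<Rightarrow> real"
  assumes lip: "\<And>x y. \<bar>g y - g x\<bar> \<le> L * \<bar>y - x\<bar>" and pq: "p < q"
  shows "negligible {x. (\<exists>\<^sub>F s in at 0. (g (x + s) - g x) / s < p) \<and>
                        (\<exists>\<^sub>F s in at 0. q < (g (x + s) - g x) / s)}" (is "negligible ?E")
proof -
  have L: "0 \<le> L" using lip[of 1 0] by simp
  define f where "f x = g x + (L + 1) * x" for x
  have up: "f y - f x \<le> (2 * L + 1) * (y - x)" and low: "y - x \<le> f y - f x" if "x \<le> y" for x y
    using lip[of y x] that by (auto simp: f_def algebra_simps abs_le_iff)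
  have quot: "(f (x + s) - f x) / s = (g (x + s) - g x) / s + (L + 1)" if "s \<noteq> 0" for x s
    using that by (simp add: f_def field_simps)
  have freq: "(\<exists>\<^sub>F s in at 0. (f (x + s) - f x) / s < p + (L + 1)) \<and>
              (\<exists>\<^sub>F s in at 0. q + (L + 1) < (f (x + s) - f x) / s)" if "x \<in> ?E" for x
  proof -
    have ev: "\<forall>\<^sub>F s in at 0. (f (x + s) - f x) / s = (g (x + s) - g x) / s + (L + 1)"
      using quot by (auto simp: eventually_at_filter)
    from that have 1: "\<exists>\<^sub>F s in at 0. (g (x + s) - g x) / s < p"
      and 2: "\<exists>\<^sub>F s in at 0. q < (g (x + s) - g x) / s" by auto
    show ?thesis
      by (intro conjI frequently_rev_mp[OF 1] frequently_rev_mp[OF 2] eventually_mono[OF ev]) auto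
  qed
  show ?thesis
  proof (cases "?E = {}")
    case False
    then obtain x where "x \<in> ?E" by blast
    then have "\<exists>\<^sub>F s in at 0. (f (x + s) - f x) / s < p + (L + 1)"
      using freq by blast
    then obtain s where s: "s \<noteq> 0" "(f (x + s) - f x) / s < p + (L + 1)"
      unfolding frequently_at using zero_less_one by blast
    have "1 \<le> (f (x + s) - f x) / s"
      using s low[of x "x + s"] low[of "x + s" x] by (cases "0 < s") (auto simp: field_simps)
    with s have p: "0 < p + (L + 1)" by linarith
    with pq have q: "0 < q + (L + 1)" by linarith
    have "negligible (?E \<inter> {-real n..real n})" for n
    proof -
      let ?S = "?E \<inter> {-real n..real n}"
      have "outer_measure_of lebesgue (f ` ?S) \<le> ennreal (p + (L + 1)) * outer_measure_of lebesgue ?S"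
        by (rule dini_real_outer_measure_le[where M = "2 * L + 1"]) (use p L up low freq in auto)
      moreover have "outer_measure_of lebesgue ?S \<le> ennreal (1 / (q + (L + 1))) * outer_measure_of lebesgue (f ` ?S)"
        by (rule dini_real_outer_measure_ge[where M = "2 * L + 1"]) (use q L up low freq in auto)
      ultimately have *: "outer_measure_of lebesgue ?S \<le>
          ennreal (1 / (q + (L + 1))) * (ennreal (p + (L + 1)) * outer_measure_of lebesgue ?S)"
        by (meson mult_left_mono order_trans zero_le)
      have "outer_measure_of lebesgue ?S < \<infinity>"
        by (rule outer_measure_of_bounded_finite) (meson bounded_Int bounded_closed_interval)
      then have "outer_measure_of lebesgue ?S = 0"
      proof (cases "outer_measure_of lebesgue ?S")
        case (real r)
        with * p q have "r \<le> 1 / (q + (L + 1)) * ((p + (L + 1)) * r)"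
          by (simp flip: ennreal_mult)
        then have "(q - p) * r \<le> 0"
          using q by (simp add: field_simps)
        with pq real show ?thesis
          by (simp add: mult_le_0_iff)
      qed auto
      then show ?thesis
        by (simp add: negligible_iff_outer_measure_0)
    qed
    then have "negligible (\<Union>n. ?E \<inter> {-real n..real n})"
      by (intro negligible_countable_Union) auto
    moreover have "?E \<subseteq> (\<Union>n. ?E \<inter> {-real n..real n})"
    proof
      fix x assume "x \<in> ?E"
      moreover obtain n :: nat where "\<bar>x\<bar> < real n" using reals_Archimedean2 by blast
      ultimately show "x \<in> (\<Union>n. ?E \<inter> {-real n..real n})" by (auto intro!: exI[of _ n])
    qed
    ultimately show ?thesis using negligible_subset by blast
  qed (simp only: negligible_empty)
qed

text \<open>Tonelli along lines in an arbitrary direction, by averaging over translates.\<close>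

lemma negligible_if_negligible_slices:
  fixes E :: "'a::euclidean_space set"
  assumes E: "E \<in> sets borel" and slices: "\<And>x. negligible {t. x + t *\<^sub>R e \<in> E}"
  shows "negligible E"
proof -
  have meas: "(\<lambda>(x, t). indicator E (x + t *\<^sub>R e) * indicator {0..1} t :: ennreal)
      \<in> borel_measurable (lborel \<Otimes>\<^sub>M (lborel :: real measure))"
    using E by measurable
  have "(\<integral>\<^sup>+x. indicator E (x + t *\<^sub>R e) \<partial>lborel) = emeasure lborel E" for t
  proof -
    have "emeasure lborel E = emeasure (distr lborel borel ((+) (t *\<^sub>R e))) E"
      by (simp only: lborel_distr_plus)
    also have "\<dots> = (\<integral>\<^sup>+x. indicator E x \<partial>distr lborel borel ((+) (t *\<^sub>R e)))"
      using E by simp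
    also have "\<dots> = (\<integral>\<^sup>+x. indicator E (t *\<^sub>R e + x) \<partial>lborel)"
      using E by (intro nn_integral_distr) auto
    finally show ?thesis by (simp add: add.commute)
  qed
  then have "(\<integral>\<^sup>+t. (\<integral>\<^sup>+x. indicator E (x + t *\<^sub>R e) * indicator {0..1} t \<partial>lborel) \<partial>lborel)
      = (\<integral>\<^sup>+t. emeasure lborel E * indicator {0..1::real} t \<partial>lborel)"
    using E by (simp add: nn_integral_multc)
  also have "\<dots> = emeasure lborel E"
    by (simp add: nn_integral_cmult)
  finally have "emeasure lborel E = (\<integral>\<^sup>+x. (\<integral>\<^sup>+t. indicator E (x + t *\<^sub>R e) * indicator {0..1} t \<partial>lborel) \<partial>lborel)"
    using lborel_pair.Fubini'[OF meas] by simp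
  also have "\<dots> = (\<integral>\<^sup>+x. 0 \<partial>(lborel :: 'a measure))"
  proof (rule nn_integral_cong)
    fix x :: 'a
    have B: "{t. x + t *\<^sub>R e \<in> E} \<in> sets borel"
      using measurable_sets[OF _ E, of "\<lambda>t. x + t *\<^sub>R e" borel] by (simp add: vimage_def)
    have "(\<integral>\<^sup>+t. indicator E (x + t *\<^sub>R e) * indicator {0..1} t \<partial>lborel)
        \<le> (\<integral>\<^sup>+t. indicator {t. x + t *\<^sub>R e \<in> E} t \<partial>lborel)"
      by (intro nn_integral_mono) (auto simp: indicator_def)
    also have "\<dots> = emeasure lborel {t. x + t *\<^sub>R e \<in> E}"
      using B by simp
    also have "\<dots> = emeasure lebesgue {t. x + t *\<^sub>R e \<in> E}"
      using B by simp
    also have "\<dots> = 0"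
      using slices[of x] by (simp add: negligible_iff_null_sets null_sets_def)
    finally show "(\<integral>\<^sup>+t. indicator E (x + t *\<^sub>R e) * indicator {0..1} t \<partial>lborel) = 0"
      by simp
  qed
  finally have "emeasure lebesgue E = 0" using E by simp
  then show ?thesis using E by (simp add: negligible_iff_null_sets null_sets_def)
qed

lemma negligible_dini_gap:
  fixes f :: "'a::euclidean_space \<Rightarrow> real"
  assumes lip: "\<And>x y. \<bar>f y - f x\<bar> \<le> L * norm (y - x)" and pq: "p < q"
  shows "negligible {x. (\<exists>\<^sub>F s in at 0. (f (x + s *\<^sub>R e) - f x) / s < p) \<and>
                        (\<exists>\<^sub>F s in at 0. q < (f (x + s *\<^sub>R e) - f x) / s)}" (is "negligible ?E")
proof (rule negligible_if_negligible_slices[where e = e])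
  have f: "continuous_on UNIV f"
    by (rule lipschitz_on_continuous_on[where L = "max L 0"])
      (auto intro!: lipschitz_onI simp: dist_norm intro!: order_trans[OF lip] mult_right_mono)
  have f': "continuous_on UNIV (\<lambda>x. f (x + s *\<^sub>R e))" for s
    by (rule continuous_on_compose2[OF f]) (auto intro!: continuous_intros)
  have cont: "continuous_on UNIV (\<lambda>x. (f (x + s *\<^sub>R e) - f x) / s)" if "s \<noteq> 0" for s
    using that by (intro continuous_on_divide continuous_on_diff f f' continuous_on_const) auto
  have eq: "?E = (\<Inter>n. \<Union>s\<in>{s. s \<noteq> 0 \<and> \<bar>s\<bar> < 1 / Suc n}. {x. (f (x + s *\<^sub>R e) - f x) / s < p}) \<inter>
      (\<Inter>n. \<Union>s\<in>{s. s \<noteq> 0 \<and> \<bar>s\<bar> < 1 / Suc n}. {x. q < (f (x + s *\<^sub>R e) - f x) / s})"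
  proof -
    have freq: "(\<exists>\<^sub>F s in at (0::real). P s) \<longleftrightarrow> (\<forall>n. \<exists>s. s \<noteq> 0 \<and> \<bar>s\<bar> < 1 / Suc n \<and> P s)" for P
    proof
      assume "\<exists>\<^sub>F s in at (0::real). P s"
      then show "\<forall>n. \<exists>s. s \<noteq> 0 \<and> \<bar>s\<bar> < 1 / Suc n \<and> P s"
        unfolding frequently_at dist_real_def by simp
    next
      assume *: "\<forall>n. \<exists>s. s \<noteq> 0 \<and> \<bar>s\<bar> < 1 / Suc n \<and> P s"
      show "\<exists>\<^sub>F s in at (0::real). P s"
        unfolding frequently_at dist_real_def
      proof (intro allI impI)
        fix d :: real assume "0 < d"
        then obtain n where "1 / Suc n < d" using nat_approx_posE by blast
        then show "\<exists>x\<in>UNIV. x \<noteq> 0 \<and> \<bar>x - 0\<bar> < d \<and> P x"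
          using * by (simp, meson less_trans)
      qed
    qed
    show ?thesis unfolding freq by auto
  qed
  show "?E \<in> sets borel"
    unfolding eq
    by (intro sets.Int sets.countable_INT' borel_open open_UN ballI open_Collect_less cont
        continuous_on_const) (auto intro!: borel_open open_UN open_Collect_less cont continuous_on_const)
next
  fix x :: 'a
  define g where "g t = f (x + t *\<^sub>R e)" for t
  have "\<bar>g y - g z\<bar> \<le> (L * norm e) * \<bar>y - z\<bar>" for y z
    unfolding g_def using lip[of "x + y *\<^sub>R e" "x + z *\<^sub>R e"]
    by (simp add: algebra_simps flip: scaleR_diff_left)
  then have "negligible {t. (\<exists>\<^sub>F s in at 0. (g (t + s) - g t) / s < p) \<and>
                        (\<exists>\<^sub>F s in at 0. q < (g (t + s) - g t) / s)}"
    using negligible_dini_gap_real pq by blast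
  then show "negligible {t. x + t *\<^sub>R e \<in> ?E}"
    by (simp add: g_def scaleR_add_left add.assoc)
qed

lemma converges_if_no_dini_gap:
  fixes h :: "real \<Rightarrow> real"
  assumes bound: "\<And>s. s \<noteq> 0 \<Longrightarrow> \<bar>h s\<bar> \<le> L"
    and nogap: "\<And>p q. p \<in> \<rat> \<Longrightarrow> q \<in> \<rat> \<Longrightarrow> p < q \<Longrightarrow>
      \<not> ((\<exists>\<^sub>F s in at 0. h s < p) \<and> (\<exists>\<^sub>F s in at 0. q < h s))"
  shows "\<exists>c. (h \<longlongrightarrow> c) (at 0)"
proof -
  let ?h = "\<lambda>s. ereal (h s)"
  have le: "Liminf (at 0) ?h \<le> Limsup (at 0) ?h"
    by (rule Liminf_le_Limsup) simp
  have "\<not> Liminf (at 0) ?h < Limsup (at 0) ?h"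
  proof
    assume "Liminf (at 0) ?h < Limsup (at 0) ?h"
    then obtain p' where p': "Liminf (at 0) ?h < ereal p'" "ereal p' < Limsup (at 0) ?h"
      using ereal_dense2 by blast
    then obtain q' where q': "ereal p' < ereal q'" "ereal q' < Limsup (at 0) ?h"
      using ereal_dense2 by blast
    then have "p' < q'" by simp
    then obtain p where p: "p \<in> \<rat>" "p' < p" "p < q'" using Rats_dense_in_real by blast
    then obtain q where q: "q \<in> \<rat>" "p < q" "q < q'" using Rats_dense_in_real by blast
    have "\<exists>\<^sub>F s in at 0. h s < p"
    proof (rule ccontr)
      assume "\<not> (\<exists>\<^sub>F s in at 0. h s < p)"
      then have "\<forall>\<^sub>F s in at 0. ereal p \<le> ?h s" by (simp add: not_frequently not_less)
      then have "ereal p \<le> Liminf (at 0) ?h" by (rule Liminf_bounded)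
      with p' have "ereal p < ereal p'" by order
      with p show False by simp
    qed
    moreover have "\<exists>\<^sub>F s in at 0. q < h s"
    proof (rule ccontr)
      assume "\<not> (\<exists>\<^sub>F s in at 0. q < h s)"
      then have "\<forall>\<^sub>F s in at 0. ?h s \<le> ereal q" by (simp add: not_frequently not_less)
      then have "Limsup (at 0) ?h \<le> ereal q" by (rule Limsup_bounded)
      with q' have "ereal q' < ereal q" by order
      with q show False by simp
    qed
    ultimately show False using nogap p q by blast
  qed
  with le have eq: "Liminf (at 0) ?h = Limsup (at 0) ?h" by order
  have "\<forall>\<^sub>F s in at 0. ereal (-L) \<le> ?h s" "\<forall>\<^sub>F s in at 0. ?h s \<le> ereal L"
    using bound by (auto simp: eventually_at_filter abs_le_iff minus_le_iff)
  then have "ereal (-L) \<le> Liminf (at 0) ?h" "Limsup (at 0) ?h \<le> ereal L"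
    by (auto intro: Liminf_bounded Limsup_bounded)
  with eq obtain c where c: "Limsup (at 0) ?h = ereal c"
    by (cases "Limsup (at 0) ?h") auto
  have "(?h \<longlongrightarrow> ereal c) (at 0)"
    by (rule Liminf_eq_Limsup) (use eq c in auto)
  then show ?thesis by auto
qed

text \<open>Following Nekvinda and Zajicek: a linear increment is tracked one coordinate at a time, each time
  passing to a nearby point of the set on which the difference quotients are uniformly close to \<open>c\<close>.\<close>

lemma increment_near_linear_at_nonporous:
  fixes f :: "'a::euclidean_space \<Rightarrow> real" and L \<epsilon> \<delta> :: real
  assumes lip: "\<And>x y. \<bar>f y - f x\<bar> \<le> L * norm (y - x)"
    and \<epsilon>: "0 < \<epsilon>" and \<delta>: "0 < \<delta>"
    and A: "\<And>y b t. y \<in> A \<Longrightarrow> b \<in> Basis \<Longrightarrow> \<bar>t\<bar> < \<delta> \<Longrightarrow> \<bar>f (y + t *\<^sub>R b) - f y - t * (c \<bullet> b)\<bar> \<le> \<epsilon> * \<bar>t\<bar>"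
    and x: "nonporous_at A x"
  shows "\<exists>d>0. \<forall>h. norm h < d \<longrightarrow> \<bar>f (x + h) - f x - c \<bullet> h\<bar> \<le> DIM('a) * (2 * L + 1) * \<epsilon> * norm h"
proof -
  obtain d where d: "0 < d" "\<And>z. dist z x < d \<Longrightarrow> \<exists>y\<in>A. dist z y \<le> \<epsilon> * dist z x"
    using x[unfolded nonporous_at_def, rule_format, OF \<epsilon>] by blast
  obtain b0 :: 'a where b0: "b0 \<in> Basis" using nonempty_Basis by blast
  have L: "0 \<le> L" using order_trans[OF abs_ge_zero lip[of b0 0]] b0 by simp
  have "0 < min d \<delta>" using d \<delta> by simp
  moreover have "\<bar>f (x + h) - f x - c \<bullet> h\<bar> \<le> DIM('a) * (2 * L + 1) * \<epsilon> * norm h"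
    if h: "norm h < min d \<delta>" for h
  proof -
    define part where "part S = (\<Sum>b\<in>S. (h \<bullet> b) *\<^sub>R b)" for S :: "'a set"
    have part_norm: "norm (part S) \<le> norm h" if "S \<subseteq> Basis" for S
    proof -
      have fin: "finite S" using that finite_Basis by (rule finite_subset)
      have "part S \<bullet> b = (if b \<in> S then h \<bullet> b else 0)" if b: "b \<in> Basis" for b
      proof -
        have "part S \<bullet> b = (\<Sum>b'\<in>S. if b' = b then h \<bullet> b else 0)"
          unfolding part_def inner_sum_left using b \<open>S \<subseteq> Basis\<close>
          by (intro sum.cong) (auto simp: inner_Basis)
        then show ?thesis using fin by simp
      qed
      then have "part S \<bullet> part S \<le> h \<bullet> h"
        unfolding euclidean_inner[of "part S" "part S"] euclidean_inner[of h h]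
        by (intro sum_mono) simp
      then show ?thesis by (simp add: norm_le)
    qed
    have step: "\<bar>f (x + part S) - f x - c \<bullet> part S\<bar> \<le> card S * ((2 * L + 1) * \<epsilon> * norm h)"
      if "finite S" "S \<subseteq> Basis" for S
      using that
    proof (induction S rule: finite_induct)
      case empty
      then show ?case by (simp add: part_def)
    next
      case (insert b S)
      define w where "w = x + part S"
      define t where "t = h \<bullet> b"
      have b: "b \<in> Basis" using insert by auto
      have t: "\<bar>t\<bar> \<le> norm h" unfolding t_def using b by (rule Basis_le_norm)
      have "dist w x \<le> norm h" using part_norm insert by (simp add: w_def dist_norm)
      then obtain y where y: "y \<in> A" "dist w y \<le> \<epsilon> * dist w x"
        using d(2)[of w] h by force
      moreover have "\<epsilon> * dist w x \<le> \<epsilon> * norm h"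
        using \<open>dist w x \<le> norm h\<close> \<epsilon> by simp
      ultimately have wy: "norm (w - y) \<le> \<epsilon> * norm h" by (simp add: dist_norm)
      have "\<bar>f (w + t *\<^sub>R b) - f (y + t *\<^sub>R b)\<bar> \<le> L * (\<epsilon> * norm h)"
        using lip[of "w + t *\<^sub>R b" "y + t *\<^sub>R b"] mult_left_mono[OF wy L] by (simp add: norm_minus_commute abs_minus_commute)
      moreover have "\<bar>f w - f y\<bar> \<le> L * (\<epsilon> * norm h)"
        using lip[of w y] mult_left_mono[OF wy L] by (simp add: norm_minus_commute abs_minus_commute)
      moreover have "\<bar>f (y + t *\<^sub>R b) - f y - t * (c \<bullet> b)\<bar> \<le> \<epsilon> * \<bar>t\<bar>"
        using A y b t h by auto
      moreover have "\<epsilon> * \<bar>t\<bar> \<le> \<epsilon> * norm h" using t \<epsilon> by simp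
      ultimately have 1: "\<bar>f (w + t *\<^sub>R b) - f w - t * (c \<bullet> b)\<bar> \<le> (2 * L + 1) * \<epsilon> * norm h"
        by (simp add: algebra_simps abs_le_iff)
      have part_insert: "part (insert b S) = part S + t *\<^sub>R b"
        using insert by (simp add: part_def t_def)
      have "\<bar>f w - f x - c \<bullet> part S\<bar> \<le> card S * ((2 * L + 1) * \<epsilon> * norm h)"
        using insert by (auto simp: w_def)
      with 1 show ?case
        using insert by (simp add: part_insert w_def algebra_simps inner_add_right abs_le_iff)
    qed
    have "part Basis = h" unfolding part_def by (rule euclidean_representation)
    with step[of Basis] show "\<bar>f (x + h) - f x - c \<bullet> h\<bar> \<le> DIM('a) * (2 * L + 1) * \<epsilon> * norm h"
      by (simp add: mult.assoc)
  qed
  ultimately show ?thesis by blast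
qed

lemma countable_dense_euclidean:
  obtains D :: "'a::euclidean_space set" where "countable D" "\<And>x e. 0 < e \<Longrightarrow> \<exists>y\<in>D. dist x y < e"
proof -
  obtain D :: "'a set" where D: "countable D" "\<And>X. open X \<Longrightarrow> X \<noteq> {} \<Longrightarrow> \<exists>d\<in>D. d \<in> X"
    using countable_dense_exists by blast
  have "\<exists>y\<in>D. dist x y < e" if "0 < e" for x e
    using D(2)[of "ball x e"] that by auto
  with D that show ?thesis by blast
qed

theorem Rademacher_real:
  fixes f :: "'a::euclidean_space \<Rightarrow> real"
  assumes lip: "\<And>x y. \<bar>f y - f x\<bar> \<le> L * norm (y - x)"
  shows "negligible {x. \<not> f differentiable (at x)}"
proof -
  obtain b0 :: 'a where b0: "b0 \<in> Basis" using nonempty_Basis by blast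
  have L: "0 \<le> L" using order_trans[OF abs_ge_zero lip[of b0 0]] b0 by simp
  obtain D :: "'a set" where D: "countable D" "\<And>x e. 0 < e \<Longrightarrow> \<exists>y\<in>D. dist x y < e"
    by (rule countable_dense_euclidean) blast
  define gap where "gap b p q = {x. (\<exists>\<^sub>F s in at 0. (f (x + s *\<^sub>R b) - f x) / s < p) \<and>
                        (\<exists>\<^sub>F s in at 0. q < (f (x + s *\<^sub>R b) - f x) / s)}" for b p q
  define G where "G = (\<Union>b\<in>Basis. \<Union>p\<in>\<rat>. \<Union>q\<in>{q\<in>\<rat>. p < q}. gap b p q)"
  define A where "A n k c = {x. \<forall>b\<in>Basis. \<forall>t. \<bar>t\<bar> < 1 / Suc k \<longrightarrow>
      \<bar>f (x + t *\<^sub>R b) - f x - t * (c \<bullet> b)\<bar> \<le> 1 / Suc n * \<bar>t\<bar>}" for n k :: nat and c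
  define H where "H = (\<Union>n. \<Union>k. \<Union>c\<in>D. {x \<in> A n k c. \<not> nonporous_at (A n k c) x})"
  have "negligible G"
    unfolding G_def gap_def
    by (intro negligible_countable_Union negligible_dini_gap[OF lip] countable_image ballI)
      (auto simp: countable_rat countable_finite intro!: negligible_countable_Union countable_image countable_subset[OF _ countable_rat] negligible_dini_gap[OF lip])
  moreover have "negligible H"
    unfolding H_def
    by (intro negligible_countable_Union) (auto intro!: negligible_countable_Union countable_image D(1) negligible_not_nonporous_at)
  ultimately have "negligible (G \<union> H)" by (rule negligible_Un)
  moreover have "f differentiable (at x)" if x: "x \<notin> G \<union> H" for x
  proof -
    have quot: "\<bar>(f (x + s *\<^sub>R b) - f x) / s\<bar> \<le> L" if "b \<in> Basis" "s \<noteq> 0" for s b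
      using lip[of "x + s *\<^sub>R b" x] that by (simp add: abs_minus_commute field_simps)
    have "\<exists>a. ((\<lambda>s. (f (x + s *\<^sub>R b) - f x) / s) \<longlongrightarrow> a) (at 0)" if b: "b \<in> Basis" for b
      by (rule converges_if_no_dini_gap[OF quot[OF b]]) (use x b in \<open>auto simp: G_def gap_def\<close>)
    then obtain a where a: "\<And>b. b \<in> Basis \<Longrightarrow> ((\<lambda>s. (f (x + s *\<^sub>R b) - f x) / s) \<longlongrightarrow> a b) (at 0)"
      by metis
    define a' where "a' = (\<Sum>b\<in>Basis. a b *\<^sub>R b)"
    have a'b: "a' \<bullet> b = a b" if "b \<in> Basis" for b
      unfolding a'_def using that by (simp add: inner_sum_left_Basis)
    define M where "M = DIM('a) * (2 * L + 1) + 1"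
    have M: "0 < M" using L by (simp add: M_def add_nonneg_pos)
    have key: "\<exists>d>0. \<forall>h. norm h < d \<longrightarrow> \<bar>f (x + h) - f x - a' \<bullet> h\<bar> \<le> M * (1 / Suc n) * norm h" for n
    proof -
      obtain c where c: "c \<in> D" "dist a' c < 1 / Suc n / 2"
        using D(2)[of "1 / Suc n / 2" a'] by auto
      have ac: "\<bar>a' \<bullet> b - c \<bullet> b\<bar> < 1 / Suc n / 2" if "b \<in> Basis" for b
        using Basis_le_norm[OF that, of "a' - c"] c by (simp add: inner_diff_left dist_norm)
      have ev: "\<forall>\<^sub>F s in at 0. \<forall>b\<in>Basis. \<bar>(f (x + s *\<^sub>R b) - f x) / s - a b\<bar> < 1 / Suc n / 2"
        using tendstoD[OF a, of _ "1 / Suc n / 2"]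
        by (intro eventually_ball_finite) (auto simp: dist_real_def)
      then obtain d where d: "0 < d" "\<And>s b. s \<noteq> 0 \<Longrightarrow> \<bar>s\<bar> < d \<Longrightarrow> b \<in> Basis \<Longrightarrow>
          \<bar>(f (x + s *\<^sub>R b) - f x) / s - a b\<bar> < 1 / Suc n / 2"
        unfolding eventually_at by (auto simp: dist_real_def)
      obtain k where k: "1 / Suc k < d" using d nat_approx_posE by blast
      have "x \<in> A n k c"
        unfolding A_def
      proof (intro CollectI ballI allI impI)
        fix b :: 'a and t :: real assume b: "b \<in> Basis" and t: "\<bar>t\<bar> < 1 / Suc k"
        show "\<bar>f (x + t *\<^sub>R b) - f x - t * (c \<bullet> b)\<bar> \<le> 1 / Suc n * \<bar>t\<bar>"
        proof (cases "t = 0")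
          case False
          have "\<bar>(f (x + t *\<^sub>R b) - f x) / t - c \<bullet> b\<bar> \<le> 1 / Suc n"
          proof -
            have "\<bar>(f (x + t *\<^sub>R b) - f x) / t - a b\<bar> < 1 / Suc n / 2"
              using d(2)[OF False _ b] t k by simp
            moreover have "\<bar>a b - c \<bullet> b\<bar> < 1 / Suc n / 2"
              using ac[OF b] by (simp add: a'b[OF b])
            moreover have "\<bar>q - c\<bar> \<le> e" if "\<bar>q - a\<bar> < e / 2" "\<bar>a - c\<bar> < e / 2" for q a c e :: real
              using that by linarith
            ultimately show ?thesis by blast
          qed
          then have "\<bar>(f (x + t *\<^sub>R b) - f x) / t - c \<bullet> b\<bar> * \<bar>t\<bar> \<le> 1 / Suc n * \<bar>t\<bar>"
            by (intro mult_right_mono) auto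
          also have "\<bar>(f (x + t *\<^sub>R b) - f x) / t - c \<bullet> b\<bar> * \<bar>t\<bar> = \<bar>f (x + t *\<^sub>R b) - f x - t * (c \<bullet> b)\<bar>"
            using False by (simp add: field_simps flip: abs_mult)
          finally show ?thesis .
        qed simp
      qed
      with x c have "nonporous_at (A n k c) x" unfolding H_def by blast
      then obtain r where r: "0 < r" "\<And>h. norm h < r \<Longrightarrow>
          \<bar>f (x + h) - f x - c \<bullet> h\<bar> \<le> DIM('a) * (2 * L + 1) * (1 / Suc n) * norm h"
        using increment_near_linear_at_nonporous[OF lip, of "1 / Suc n" "1 / Suc k" "A n k c" c x]
        unfolding A_def by auto
      have "\<bar>f (x + h) - f x - a' \<bullet> h\<bar> \<le> M * (1 / Suc n) * norm h" if h: "norm h < r" for h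
      proof -
        have "\<bar>(a' - c) \<bullet> h\<bar> \<le> norm (a' - c) * norm h" by (rule Cauchy_Schwarz_ineq2)
        also have "\<dots> \<le> 1 / Suc n * norm h"
          using c(2) by (intro mult_right_mono) (auto simp: dist_norm field_simps)
        finally have "\<bar>c \<bullet> h - a' \<bullet> h\<bar> \<le> 1 / Suc n * norm h"
          by (simp add: inner_diff_left abs_minus_commute)
        moreover have "M * (1 / Suc n) * norm h = DIM('a) * (2 * L + 1) * (1 / Suc n) * norm h + 1 / Suc n * norm h"
          unfolding M_def by (simp only: distrib_right mult_1)
        ultimately show ?thesis using r(2)[OF h] by linarith
      qed
      with r show ?thesis by blast
    qed
    have "(f has_derivative (\<lambda>h. a' \<bullet> h)) (at x)"
      unfolding has_derivative_at_alt
    proof (intro conjI bounded_linear_inner_right allI impI)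
      fix e :: real assume "0 < e"
      then have "0 < e / M" using M by simp
      then obtain n where n: "1 / Suc n < e / M" using nat_approx_posE by blast
      then have "M * (1 / Suc n) \<le> e" using M by (simp add: field_simps)
      then have le: "M * (1 / Suc n) * norm h \<le> e * norm h" for h :: 'a
        by (rule mult_right_mono) simp
      obtain d where d: "0 < d" "\<And>h. norm h < d \<Longrightarrow> \<bar>f (x + h) - f x - a' \<bullet> h\<bar> \<le> M * (1 / Suc n) * norm h"
        using key[of n] by blast
      have "norm (f y - f x - a' \<bullet> (y - x)) \<le> e * norm (y - x)" if "norm (y - x) < d" for y
        using order_trans[OF d(2)[OF that] le] by simp
      with d show "\<exists>d>0. \<forall>y. norm (y - x) < d \<longrightarrow> norm (f y - f x - a' \<bullet> (y - x)) \<le> e * norm (y - x)"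
        by blast
    qed
    then show ?thesis unfolding differentiable_def by blast
  qed
  ultimately show ?thesis
    by (metis (mono_tags, lifting) mem_Collect_eq negligible_subset subsetI)
qed

section \<open>Second-order expansions at contact points\<close>

lemma Lipschitz_extension_real:
  fixes g :: "'a::real_normed_vector \<Rightarrow> real"
  assumes "K \<noteq> {}" and L: "0 \<le> L"
    and lip: "\<And>x y. x \<in> K \<Longrightarrow> y \<in> K \<Longrightarrow> \<bar>g y - g x\<bar> \<le> L * norm (y - x)"
  obtains G where "\<And>x y. \<bar>G y - G x\<bar> \<le> L * norm (y - x)" "\<And>x. x \<in> K \<Longrightarrow> G x = g x"
proof -
  define G where "G x = (INF y\<in>K. g y + L * norm (x - y))" for x
  obtain k where k: "k \<in> K" using \<open>K \<noteq> {}\<close> by auto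
  have bdd: "bdd_below ((\<lambda>y. g y + L * norm (x - y)) ` K)" for x
  proof (rule bdd_belowI2[where m = "g k - L * norm (x - k)"])
    fix y assume "y \<in> K"
    then have "g k - g y \<le> L * norm (k - y)" using lip[of y k] k by auto
    also have "\<dots> \<le> L * (norm (x - k) + norm (x - y))"
      using L norm_triangle_ineq4[of "x - y" "x - k"] by (intro mult_left_mono) (auto simp: norm_minus_commute)
    finally show "g k - L * norm (x - k) \<le> g y + L * norm (x - y)" by (simp add: algebra_simps)
  qed
  have le: "G x \<le> G y + L * norm (y - x)" for x y
  proof -
    have "G x - L * norm (y - x) \<le> g z + L * norm (y - z)" if "z \<in> K" for z
    proof -
      have "G x \<le> g z + L * norm (x - z)"
        unfolding G_def using bdd that by (rule cINF_lower)
      also have "\<dots> \<le> g z + L * (norm (y - x) + norm (y - z))"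
        using L norm_triangle_ineq4[of "y - z" "y - x"] by (intro add_left_mono mult_left_mono) auto
      finally show ?thesis by (simp add: algebra_simps)
    qed
    then have "G x - L * norm (y - x) \<le> G y"
      unfolding G_def[of y] using \<open>K \<noteq> {}\<close> by (intro cINF_greatest) auto
    then show ?thesis by simp
  qed
  have "\<bar>G y - G x\<bar> \<le> L * norm (y - x)" for x y
    using le[of x y] le[of y x] by (simp add: norm_minus_commute)
  moreover have "G x = g x" if "x \<in> K" for x
  proof (rule antisym)
    show "G x \<le> g x"
      unfolding G_def using cINF_lower[OF bdd that, of x] by simp
    show "g x \<le> G x"
      unfolding G_def
    proof (rule cINF_greatest)
      fix y assume "y \<in> K"
      then show "g x \<le> g y + L * norm (x - y)" using lip[of y x] that by auto
    qed (use \<open>K \<noteq> {}\<close> in auto)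
  qed
  ultimately show ?thesis using that by blast
qed

lemma Lipschitz_on_nonnegligible_differentiable_point:
  fixes G :: "'a::euclidean_space \<Rightarrow> 'a"
  assumes K: "\<not> negligible K" and L: "0 \<le> L"
    and lip: "\<And>x y. x \<in> K \<Longrightarrow> y \<in> K \<Longrightarrow> norm (G y - G x) \<le> L * norm (y - x)"
  obtains x B where "x \<in> K" "nonporous_at K x" "bounded_linear B"
    "\<And>e. 0 < e \<Longrightarrow> \<exists>d>0. \<forall>y\<in>K. norm (y - x) < d \<longrightarrow> norm (G y - G x - B (y - x)) \<le> e * norm (y - x)"
proof -
  have "K \<noteq> {}" using K by auto
  have "\<exists>E. (\<forall>x y. \<bar>E y - E x\<bar> \<le> L * norm (y - x)) \<and> (\<forall>x\<in>K. E x = G x \<bullet> b)"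
    if b: "b \<in> Basis" for b
  proof -
    have "\<bar>G y \<bullet> b - G x \<bullet> b\<bar> \<le> L * norm (y - x)" if "x \<in> K" "y \<in> K" for x y
      using Basis_le_norm[OF b, of "G y - G x"] lip[OF that] by (simp add: inner_diff_left)
    then show ?thesis
      by (rule Lipschitz_extension_real[OF \<open>K \<noteq> {}\<close> L, of "\<lambda>x. G x \<bullet> b"]) blast+
  qed
  then obtain E where E: "\<And>b x y. b \<in> Basis \<Longrightarrow> \<bar>E b y - E b x\<bar> \<le> L * norm (y - x)"
    "\<And>b x. b \<in> Basis \<Longrightarrow> x \<in> K \<Longrightarrow> E b x = G x \<bullet> b"
    by metis
  define N where "N = (\<Union>b\<in>Basis. {x. \<not> E b differentiable (at x)}) \<union> {x \<in> K. \<not> nonporous_at K x}"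
  have "negligible N"
    unfolding N_def
    by (intro negligible_Un negligible_not_nonporous_at negligible_Union finite_imageI)
      (auto intro!: Rademacher_real E)
  then have "\<not> K \<subseteq> N" using K negligible_subset[of N K] by blast
  then obtain x where x: "x \<in> K" "x \<notin> N" by blast
  define H where "H y = (\<Sum>b\<in>Basis. E b y *\<^sub>R b)" for y
  have Hb: "H y \<bullet> b = E b y" if "b \<in> Basis" for y b
    unfolding H_def using that by (simp add: inner_sum_left_Basis)
  have "H differentiable (at x)"
    using x(2) by (subst differentiable_componentwise_within) (simp add: Hb N_def)
  then obtain B where B: "(H has_derivative B) (at x)"
    unfolding differentiable_def by blast
  have HG: "H y = G y" if "y \<in> K" for y
    by (rule euclidean_eqI) (use that E Hb in auto)
  show ?thesis
  proof
    show "nonporous_at K x" using x unfolding N_def by blast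
    show "bounded_linear B" using B by (rule has_derivative_bounded_linear)
    fix e :: real assume "0 < e"
    then obtain d where "d > 0" "\<forall>y. norm (y - x) < d \<longrightarrow> norm (H y - H x - B (y - x)) \<le> e * norm (y - x)"
      using B unfolding has_derivative_at_alt by blast
    then show "\<exists>d>0. \<forall>y\<in>K. norm (y - x) < d \<longrightarrow> norm (G y - G x - B (y - x)) \<le> e * norm (y - x)"
      using HG x by (metis (no_types, lifting))
  qed (use x in auto)
qed

lemma gradient_Lipschitz_if_touched_by_paraboloids:
  fixes f :: "'a::euclidean_space \<Rightarrow> real"
  assumes touch: "\<And>y z. y \<in> K \<Longrightarrow> \<bar>f z - f y - G y \<bullet> (z - y)\<bar> \<le> C * (norm (z - y))\<^sup>2"
    and xy: "x \<in> K" "y \<in> K"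
  shows "norm (G y - G x) \<le> 6 * C * norm (y - x)"
proof (cases "G y = G x")
  case True
  obtain b :: 'a where b: "b \<in> Basis" using nonempty_Basis by blast
  have "0 \<le> C" using order_trans[OF abs_ge_zero touch[OF xy(1), of "x + b"]] b by simp
  with True show ?thesis by simp
next
  case False
  define e where "e = (1 / norm (G y - G x)) *\<^sub>R (G y - G x)"
  have e: "norm e = 1" "(G y - G x) \<bullet> e = norm (G y - G x)"
    using False by (auto simp: e_def dot_square_norm power2_eq_square)
  define r where "r = norm (y - x)"
  have "x \<noteq> y" using False by auto
  then have r: "0 < r" by (simp add: r_def)
  obtain b :: 'a where b: "b \<in> Basis" using nonempty_Basis by blast
  have C: "0 \<le> C" using order_trans[OF abs_ge_zero touch[OF xy(1), of "x + b"]] b by simp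
  define z where "z = y + r *\<^sub>R e"
  have "\<bar>f z - f y - G y \<bullet> (r *\<^sub>R e)\<bar> \<le> C * r\<^sup>2"
    using touch[OF xy(2), of z] e r by (simp add: z_def)
  moreover have "\<bar>f z - f x - G x \<bullet> (y - x + r *\<^sub>R e)\<bar> \<le> C * (2 * r)\<^sup>2"
  proof -
    have "norm (z - x) \<le> 2 * r"
      using norm_triangle_ineq[of "y - x" "r *\<^sub>R e"] e r by (simp add: z_def r_def algebra_simps)
    then have "C * (norm (z - x))\<^sup>2 \<le> C * (2 * r)\<^sup>2"
      using C by (intro mult_left_mono power_mono) auto
    then show ?thesis using touch[OF xy(1), of z] by (simp add: z_def algebra_simps)
  qed
  moreover have "\<bar>f y - f x - G x \<bullet> (y - x)\<bar> \<le> C * r\<^sup>2"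
    using touch[OF xy(1), of y] by (simp add: r_def)
  ultimately have "G y \<bullet> (r *\<^sub>R e) - G x \<bullet> (r *\<^sub>R e) \<le> 6 * C * r\<^sup>2"
    by (simp add: inner_add_right power_mult_distrib abs_le_iff)
  then have "r * ((G y - G x) \<bullet> e) \<le> r * (6 * C * r)"
    by (simp add: inner_diff_left power2_eq_square algebra_simps)
  with r e show ?thesis by (simp add: r_def)
qed

text \<open>Integrates the first-order expansion of \<open>G\<close> on \<open>K\<close> along the segment from \<open>x\<close> to \<open>x + h\<close> by a
  Riemann sum with \<open>m\<close> steps, each based at a point of \<open>K\<close> at distance at most \<open>norm h / m\<close>.\<close>

lemma second_order_expansion_at_nonporous:
  fixes f :: "'a::euclidean_space \<Rightarrow> real"
  assumes touch: "\<And>y z. y \<in> K \<Longrightarrow> \<bar>f z - f y - G y \<bullet> (z - y)\<bar> \<le> C * (norm (z - y))\<^sup>2"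
    and x: "x \<in> K" "nonporous_at K x" and B: "bounded_linear B"
    and diff: "\<And>e. 0 < e \<Longrightarrow> \<exists>d>0. \<forall>y\<in>K. norm (y - x) < d \<longrightarrow> norm (G y - G x - B (y - x)) \<le> e * norm (y - x)"
    and \<kappa>: "0 < (\<kappa>::real)"
  shows "\<exists>d>0. \<forall>h. norm h < d \<longrightarrow> \<bar>f (x + h) - f x - G x \<bullet> h - (h \<bullet> B h) / 2\<bar> \<le> \<kappa> * (norm h)\<^sup>2"
proof -
  obtain b0 :: 'a where b0: "b0 \<in> Basis" using nonempty_Basis by blast
  have C: "0 \<le> C" using order_trans[OF abs_ge_zero touch[OF x(1), of "x + b0"]] b0 by simp
  define \<beta> where "\<beta> = onorm B"
  have \<beta>: "0 \<le> \<beta>" "\<And>v. norm (B v) \<le> \<beta> * norm v"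
    using onorm_pos_le[OF B] onorm[OF B] by (auto simp: \<beta>_def)
  interpret B: bounded_linear B by (rule B)
  define M where "M = 5 * C + 2 + 2 * \<beta>"
  have M: "0 < M" using C \<beta> by (simp add: M_def)
  obtain m :: nat where m: "M / \<kappa> < real m" using reals_Archimedean2 by blast
  have "0 < M / \<kappa>" using M \<kappa> by simp
  with m have m0: "0 < real m" by linarith
  have Mm: "M / m \<le> \<kappa>" using m m0 \<kappa> by (simp add: field_simps)
  have m1: "0 < 1 / real m" using m0 by simp
  obtain d1 where d1: "0 < d1" "\<And>z. dist z x < d1 \<Longrightarrow> \<exists>y\<in>K. dist z y \<le> 1 / real m * dist z x"
    using x(2)[unfolded nonporous_at_def, rule_format, OF m1] by blast
  obtain d2 where d2: "0 < d2" "\<And>y. y \<in> K \<Longrightarrow> norm (y - x) < d2 \<Longrightarrow>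
      norm (G y - G x - B (y - x)) \<le> 1 / real m * norm (y - x)"
    using diff[OF m1] by blast
  have "\<bar>f (x + h) - f x - G x \<bullet> h - (h \<bullet> B h) / 2\<bar> \<le> \<kappa> * (norm h)\<^sup>2" if h: "norm h < min d1 (d2 / 2)" for h
  proof -
    define n where "n = norm h"
    define w where "w k = x + (real k / m) *\<^sub>R h" for k
    define E where "E = M * n\<^sup>2 / m\<^sup>2"
    have n0: "0 \<le> n" by (simp add: n_def)
    have step: "\<bar>f (w (Suc k)) - f (w k) - (G x \<bullet> h) / m - k / m\<^sup>2 * (h \<bullet> B h)\<bar> \<le> (5 * C + 2 + \<beta>) * n\<^sup>2 / m\<^sup>2"
      if k: "k < m" for k
    proof -
      define s where "s = (1 / real m) *\<^sub>R h"
      have ws: "w (Suc k) = w k + s"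
        by (simp add: w_def s_def add_divide_distrib scaleR_add_left)
      have s: "norm s = n / m" using m0 by (simp add: s_def n_def)
      have "dist (w k) x = real k / m * n" using m0 by (simp add: w_def dist_norm n_def)
      also have "\<dots> \<le> 1 * n" using k n0 by (intro mult_right_mono) auto
      finally have wx: "dist (w k) x \<le> n" by simp
      then obtain y where y: "y \<in> K" "dist (w k) y \<le> 1 / real m * dist (w k) x"
        using d1(2)[of "w k"] h n_def by auto
      have "1 / real m * dist (w k) x \<le> 1 / real m * n" using wx by (intro mult_left_mono) auto
      with y have wy: "norm (w k - y) \<le> n / m" by (simp add: dist_norm)
      have "n / m \<le> n" using m0 n0 k by (simp add: field_simps mult_le_cancel_left1)
      then have yx: "norm (y - x) \<le> 2 * n"
        using wx wy norm_triangle_ineq4[of "w k - x" "w k - y"] by (simp add: dist_norm)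
      have 1: "\<bar>f (w k) - f y - G y \<bullet> (w k - y)\<bar> \<le> C * (n / m)\<^sup>2"
        by (rule order_trans[OF touch[OF y(1)]]) (use wy C in \<open>intro mult_left_mono power_mono; simp\<close>)
      have "norm (w k + s - y) \<le> 2 * (n / m)"
        using norm_triangle_ineq[of "w k - y" s] wy s by (simp add: add_diff_eq diff_add_eq)
      then have 2: "\<bar>f (w k + s) - f y - G y \<bullet> (w k + s - y)\<bar> \<le> C * (2 * (n / m))\<^sup>2"
        by (intro order_trans[OF touch[OF y(1)]] mult_left_mono power_mono) (use C in auto)
      have 3: "\<bar>f (w k + s) - f (w k) - G y \<bullet> s\<bar> \<le> 5 * C * (n / m)\<^sup>2"
        using 1 2 by (simp add: inner_diff_right inner_add_right power_mult_distrib abs_le_iff power_divide)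
      define r where "r = G y - G x - (real k / m) *\<^sub>R B h"
      have "norm (G y - G x - B (y - x)) \<le> 1 / m * norm (y - x)"
        using d2(2)[OF y(1)] yx h n_def by auto
      also have "\<dots> \<le> 1 / m * (2 * n)" using yx by (intro mult_left_mono) auto
      finally have "norm (G y - G x - B (y - x)) \<le> 2 * (n / m)" by simp
      moreover have "norm (B (y - w k)) \<le> \<beta> * (n / m)"
        using \<beta>(2)[of "y - w k"] mult_left_mono[OF wy \<beta>(1)] by (simp add: norm_minus_commute)
      moreover have "r = (G y - G x - B (y - x)) + B (y - w k)"
        by (simp add: r_def w_def B.diff B.add B.scaleR)
      ultimately have "norm r \<le> (2 + \<beta>) * (n / m)"
        using norm_triangle_ineq[of "G y - G x - B (y - x)" "B (y - w k)"]
        by (simp add: distrib_right add_divide_distrib)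
      then have "norm r * norm s \<le> (2 + \<beta>) * (n / m) * (n / m)"
        unfolding s using n0 m0 by (intro mult_right_mono) auto
      with Cauchy_Schwarz_ineq2[of r s] have 4: "\<bar>r \<bullet> s\<bar> \<le> (2 + \<beta>) * (n / m)\<^sup>2"
        by (simp add: power2_eq_square mult.assoc)
      have "r \<bullet> s = G y \<bullet> s - (G x \<bullet> h) / m - k / m\<^sup>2 * (h \<bullet> B h)"
        by (simp add: r_def s_def inner_diff_left power2_eq_square inner_commute[of "B h"] diff_divide_distrib)
      with 3 4 have "\<bar>f (w k + s) - f (w k) - (G x \<bullet> h) / m - k / m\<^sup>2 * (h \<bullet> B h)\<bar>
          \<le> 5 * C * (n / m)\<^sup>2 + (2 + \<beta>) * (n / m)\<^sup>2"
        by (simp add: abs_le_iff)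
      also have "\<dots> = (5 * C + 2 + \<beta>) * n\<^sup>2 / m\<^sup>2"
        by (simp add: power_divide algebra_simps add_divide_distrib)
      finally show ?thesis by (simp only: ws)
    qed
    have hB: "\<bar>h \<bullet> B h\<bar> \<le> \<beta> * n\<^sup>2"
      using Cauchy_Schwarz_ineq2[of h "B h"] mult_left_mono[OF \<beta>(2)[of h] norm_ge_zero[of h]]
      by (simp add: n_def power2_eq_square algebra_simps)
    have "\<bar>f (w k) - f x - k / m * (G x \<bullet> h) - (k / m)\<^sup>2 * (h \<bullet> B h) / 2\<bar> \<le> k * E" if "k \<le> m" for k
      using that
    proof (induction k)
      case 0
      then show ?case by (simp add: w_def)
    next
      case (Suc k)
      have "\<bar>f (w k) - f x - k / m * (G x \<bullet> h) - (k / m)\<^sup>2 * (h \<bullet> B h) / 2\<bar> \<le> k * E"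
        using Suc by simp
      moreover have "\<bar>f (w (Suc k)) - f (w k) - (G x \<bullet> h) / m - k / m\<^sup>2 * (h \<bullet> B h)\<bar> \<le> (5 * C + 2 + \<beta>) * n\<^sup>2 / m\<^sup>2"
        using step Suc by simp
      moreover have "\<bar>1 / m\<^sup>2 * (h \<bullet> B h) / 2\<bar> \<le> \<beta> * n\<^sup>2 / m\<^sup>2"
        using hB \<beta> n0 m0 by (simp add: abs_mult divide_simps)
      moreover have "Suc k / m * (G x \<bullet> h) = k / m * (G x \<bullet> h) + (G x \<bullet> h) / m"
        using m0 by (simp add: field_simps)
      moreover have "(Suc k / m)\<^sup>2 * (h \<bullet> B h) / 2 =
          (k / m)\<^sup>2 * (h \<bullet> B h) / 2 + k / m\<^sup>2 * (h \<bullet> B h) + 1 / m\<^sup>2 * (h \<bullet> B h) / 2"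
        using m0 by (simp add: field_simps power2_eq_square)
      moreover have "Suc k * E = k * E + (5 * C + 2 + \<beta>) * n\<^sup>2 / m\<^sup>2 + \<beta> * n\<^sup>2 / m\<^sup>2"
        by (simp add: E_def M_def algebra_simps add_divide_distrib)
      ultimately show ?case by (simp only: abs_le_iff) linarith
    qed
    from this[of m] have "\<bar>f (x + h) - f x - G x \<bullet> h - (h \<bullet> B h) / 2\<bar> \<le> m * E"
      using m0 by (simp add: w_def)
    also have "m * E = M / m * n\<^sup>2" using m0 by (simp add: E_def field_simps power2_eq_square)
    also have "\<dots> \<le> \<kappa> * n\<^sup>2" using Mm by (intro mult_right_mono) auto
    finally show ?thesis by (simp add: n_def)
  qed
  moreover have "0 < min d1 (d2 / 2)" using d1 d2 by simp
  ultimately show ?thesis by blast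
qed

lemma eq_0_if_inner_le_quadratic:
  fixes v :: "'a::real_inner"
  assumes "\<And>h. v \<bullet> h \<le> C * (norm h)\<^sup>2"
  shows "v = 0"
proof (rule ccontr)
  assume "v \<noteq> 0"
  then have v: "0 < v \<bullet> v" by simp
  define t where "t = 1 / (\<bar>C\<bar> + 1)"
  have t: "0 < t" "\<bar>C\<bar> * t < 1" by (auto simp: t_def field_simps)
  have "t * (v \<bullet> v) \<le> C * t * (t * (v \<bullet> v))"
    using assms[of "t *\<^sub>R v"] by (simp add: power_mult_distrib power2_eq_square dot_square_norm algebra_simps)
  then have "1 \<le> C * t" using t v by (simp add: mult_le_cancel_right1)
  moreover have "C * t \<le> \<bar>C\<bar> * t" using t by (intro mult_right_mono) auto
  ultimately show False using t by linarith
qed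

lemma continuous_if_paraboloid_below:
  fixes f :: "'a::euclidean_space \<Rightarrow> real"
  assumes "\<And>x. \<exists>a. \<forall>z. f x + a \<bullet> (z - x) - C * (norm (z - x))\<^sup>2 \<le> f z"
  shows "continuous_on UNIV f"
proof -
  define F where "F z = f z + C * (z \<bullet> z)" for z
  have supp: "\<exists>a. \<forall>z. F x + a \<bullet> (z - x) \<le> F z" for x
  proof -
    obtain a where a: "\<And>z. f x + a \<bullet> (z - x) - C * (norm (z - x))\<^sup>2 \<le> f z" using assms by blast
    have "F x + (a + (2 * C) *\<^sub>R x) \<bullet> (z - x) \<le> F z" for z
      using a[of z] unfolding F_def power2_norm_eq_inner by (simp add: algebra_simps inner_commute)
    then show ?thesis by blast
  qed
  have "convex_on UNIV F"
  proof (rule convex_onI)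
    fix t :: real and x y :: 'a assume t: "0 < t" "t < 1"
    define w where "w = (1 - t) *\<^sub>R x + t *\<^sub>R y"
    obtain a where a: "\<And>z. F w + a \<bullet> (z - w) \<le> F z" using supp by blast
    have "(1 - t) * (F w + a \<bullet> (x - w)) + t * (F w + a \<bullet> (y - w)) \<le> (1 - t) * F x + t * F y"
      using t a by (intro add_mono mult_left_mono) auto
    moreover have "(1 - t) * (F w + a \<bullet> (x - w)) + t * (F w + a \<bullet> (y - w)) = F w"
      by (simp add: w_def algebra_simps)
    ultimately show "F ((1 - t) *\<^sub>R x + t *\<^sub>R y) \<le> (1 - t) * F x + t * F y"
      by (simp add: w_def)
  qed simp
  then have "continuous_on UNIV F" by (rule convex_on_continuous[OF open_UNIV])
  then have "continuous_on UNIV (\<lambda>z. F z - C * (z \<bullet> z))"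
    by (intro continuous_intros)
  then show ?thesis by (simp add: F_def)
qed

text \<open>The set of contact points of \<open>f - g\<close> with small affine tilts is not negligible, since the tilt is a Lipschitz
  function of the contact point and takes all small values. On this set \<open>f\<close> is touched from both sides by
  paraboloids, so \<open>f\<close> has a second-order expansion at one of these points, and \<open>g\<close> inherits it from below.\<close>

lemma semiconvex_difference_second_order:
  fixes f g :: "'a::euclidean_space \<Rightarrow> real"
  assumes C: "0 \<le> C"
    and f: "\<And>x. \<exists>a. \<forall>z. f x + a \<bullet> (z - x) - C * (norm (z - x))\<^sup>2 \<le> f z"
    and g: "\<And>x. \<exists>a. \<forall>z. g z \<le> g x + a \<bullet> (z - x) + C * (norm (z - x))\<^sup>2"
    and decay: "\<And>x. R \<le> norm (x - x0) \<Longrightarrow> f x - g x \<le> f x0 - g x0 - norm (x - x0)"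
    and \<sigma>: "0 < \<sigma>"
  obtains x p q B where "f x0 - g x0 - \<sigma> \<le> f x - g x" "bounded_linear B"
    "\<And>\<kappa>. 0 < \<kappa> \<Longrightarrow> \<exists>d>0. \<forall>h. norm h < d \<longrightarrow>
        f (x + h) \<le> f x + p \<bullet> h + (h \<bullet> B h) / 2 + \<kappa> * (norm h)\<^sup>2 \<and>
        g x + q \<bullet> h + (h \<bullet> B h) / 2 - \<kappa> * (norm h)\<^sup>2 \<le> g (x + h)"
proof -
  define W where "W x = f x - g x" for x
  obtain a where a: "\<And>x z. f x + a x \<bullet> (z - x) - C * (norm (z - x))\<^sup>2 \<le> f z"
    using f by metis
  obtain b where b: "\<And>x z. g z \<le> g x + b x \<bullet> (z - x) + C * (norm (z - x))\<^sup>2"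
    using g by metis
  have "continuous_on UNIV (\<lambda>x. - g x)"
  proof (rule continuous_if_paraboloid_below)
    fix x show "\<exists>a. \<forall>z. - g x + a \<bullet> (z - x) - C * (norm (z - x))\<^sup>2 \<le> - g z"
      by (rule exI[of _ "- b x"]) (use b[of _ x] in \<open>auto simp: algebra_simps\<close>)
  qed
  moreover have "continuous_on UNIV f" using f by (rule continuous_if_paraboloid_below)
  ultimately have contW: "continuous_on UNIV W"
    unfolding W_def using continuous_on_add by fastforce
  define R' where "R' = max R 1"
  have R': "0 < R'" "\<And>x. R' \<le> norm (x - x0) \<Longrightarrow> W x \<le> W x0 - norm (x - x0)"
    using decay by (auto simp: R'_def W_def)
  define \<rho> where "\<rho> = min (1 / 2) (\<sigma> / R')"
  have \<rho>: "0 < \<rho>" "\<rho> \<le> 1 / 2" "\<rho> * R' \<le> \<sigma>"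
    using \<sigma> R' by (auto simp: \<rho>_def min_def field_simps)
  define contact where "contact p x \<longleftrightarrow> (\<forall>z. W z \<le> W x + p \<bullet> (z - x)) \<and> W x0 - \<sigma> \<le> W x" for p x
  have ex: "\<exists>x. contact p x" if p: "norm p \<le> \<rho>" for p
  proof -
    have "continuous_on (cball x0 R') (\<lambda>z. W z - p \<bullet> (z - x0))"
      by (intro continuous_intros continuous_on_subset[OF contW]) auto
    then obtain x where x: "x \<in> cball x0 R'"
      and max: "\<And>z. z \<in> cball x0 R' \<Longrightarrow> W z - p \<bullet> (z - x0) \<le> W x - p \<bullet> (x - x0)"
      using continuous_attains_sup[of "cball x0 R'" "\<lambda>z. W z - p \<bullet> (z - x0)"] R' by auto
    have x0: "W x0 \<le> W x - p \<bullet> (x - x0)" using max[of x0] R' by simp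
    have CS: "\<bar>p \<bullet> v\<bar> \<le> \<rho> * norm v" for v
      using Cauchy_Schwarz_ineq2[of p v] mult_right_mono[OF p norm_ge_zero[of v]] by linarith
    have "W z \<le> W x + p \<bullet> (z - x)" for z
    proof -
      have "W z - p \<bullet> (z - x0) \<le> W x - p \<bullet> (x - x0)"
      proof (cases "z \<in> cball x0 R'")
        case False
        then have "W z \<le> W x0 - norm (z - x0)" using R'(2)[of z] by (simp add: dist_norm norm_minus_commute)
        moreover have "\<rho> * norm (z - x0) \<le> 1 / 2 * norm (z - x0)" using \<rho> by (intro mult_right_mono) auto
        ultimately show ?thesis using x0 CS[of "z - x0"] norm_ge_zero[of "z - x0"] by linarith
      qed (use max in auto)
      then show ?thesis by (simp add: inner_diff_right)
    qed
    moreover have "\<rho> * norm (x - x0) \<le> \<rho> * R'"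
      using x \<rho> by (intro mult_left_mono) (auto simp: dist_norm norm_minus_commute)
    then have "W x0 - \<sigma> \<le> W x" using x0 CS[of "x - x0"] \<rho> by linarith
    ultimately show ?thesis unfolding contact_def by blast
  qed
  have slope: "p = a x - b x" if "contact p x" for p x
  proof -
    have "(a x - b x - p) \<bullet> h \<le> (2 * C) * (norm h)\<^sup>2" for h
      using a[of x "x + h"] b[of "x + h" x] that[unfolded contact_def W_def, THEN conjunct1, rule_format, of "x + h"]
      by (simp add: inner_diff_left)
    then have "a x - b x - p = 0" by (rule eq_0_if_inner_le_quadratic)
    then show ?thesis by simp
  qed
  define K where "K = {x. contact (a x - b x) x}"
  have KW: "W z \<le> W x + (a x - b x) \<bullet> (z - x)" if "x \<in> K" for x z
    using that by (simp add: K_def contact_def)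
  have touchW: "\<bar>W z - W x - (a x - b x) \<bullet> (z - x)\<bar> \<le> (2 * C) * (norm (z - x))\<^sup>2" if "x \<in> K" for x z
  proof -
    have "0 \<le> C * (norm (z - x))\<^sup>2" using C by simp
    then show ?thesis
      using KW[OF that, of z] a[of x z] b[of z x] by (simp add: W_def inner_diff_left abs_le_iff)
  qed
  have touchf: "\<bar>f z - f x - a x \<bullet> (z - x)\<bar> \<le> C * (norm (z - x))\<^sup>2" if "x \<in> K" for x z
    using KW[OF that, of z] a[of x z] b[of z x] by (simp add: W_def inner_diff_left abs_le_iff)
  have "\<not> negligible K"
  proof
    assume K: "negligible K"
    have "negligible ((\<lambda>x. a x - b x) ` K)"
    proof (rule negligible_locally_Lipschitz_image[OF order_refl K])
      fix x assume x: "x \<in> K"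
      have "norm ((a y - b y) - (a x - b x)) \<le> 6 * (2 * C) * norm (y - x)" if "y \<in> K" for y
        using touchW x that by (rule gradient_Lipschitz_if_touched_by_paraboloids)
      then show "\<exists>T B. open T \<and> x \<in> T \<and> (\<forall>y\<in>K \<inter> T. norm ((a y - b y) - (a x - b x)) \<le> B * norm (y - x))"
        by (intro exI[of _ UNIV] exI[of _ "6 * (2 * C)"]) auto
    qed
    moreover have "ball 0 \<rho> \<subseteq> (\<lambda>x. a x - b x) ` K"
    proof
      fix p :: 'a assume "p \<in> ball 0 \<rho>"
      then obtain x where x: "contact p x" using ex[of p] by (auto simp: less_imp_le)
      then show "p \<in> (\<lambda>x. a x - b x) ` K"
        using slope[OF x] by (auto simp: K_def)
    qed
    ultimately have "negligible (ball (0::'a) \<rho>)" using negligible_subset by blast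
    then show False using \<rho> open_not_negligible[of "ball (0::'a) \<rho>"] by auto
  qed
  moreover have "norm (a y - a x) \<le> 6 * C * norm (y - x)" if "x \<in> K" "y \<in> K" for x y
    using touchf that by (rule gradient_Lipschitz_if_touched_by_paraboloids)
  moreover have "0 \<le> 6 * C" using C by simp
  ultimately obtain x B where x: "x \<in> K" "nonporous_at K x" and B: "bounded_linear B"
    and diff: "\<And>e. 0 < e \<Longrightarrow> \<exists>d>0. \<forall>y\<in>K. norm (y - x) < d \<longrightarrow> norm (a y - a x - B (y - x)) \<le> e * norm (y - x)"
    using Lipschitz_on_nonnegligible_differentiable_point[of K "6 * C" a] by blast
  show ?thesis
  proof
    show "f x0 - g x0 - \<sigma> \<le> f x - g x" using x by (simp add: K_def contact_def W_def)
    fix \<kappa> :: real assume "0 < \<kappa>"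
    then obtain d where "0 < d" and d: "\<And>h. norm h < d \<Longrightarrow> \<bar>f (x + h) - f x - a x \<bullet> h - (h \<bullet> B h) / 2\<bar> \<le> \<kappa> * (norm h)\<^sup>2"
      using second_order_expansion_at_nonporous[OF touchf x B diff] by blast
    have "f (x + h) \<le> f x + a x \<bullet> h + (h \<bullet> B h) / 2 + \<kappa> * (norm h)\<^sup>2 \<and>
        g x + b x \<bullet> h + (h \<bullet> B h) / 2 - \<kappa> * (norm h)\<^sup>2 \<le> g (x + h)" if "norm h < d" for h
      using d[OF that] KW[OF x(1), of "x + h"] by (simp add: W_def inner_diff_left abs_le_iff)
    with \<open>0 < d\<close> show "\<exists>d>0. \<forall>h. norm h < d \<longrightarrow>
        f (x + h) \<le> f x + a x \<bullet> h + (h \<bullet> B h) / 2 + \<kappa> * (norm h)\<^sup>2 \<and>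
        g x + b x \<bullet> h + (h \<bullet> B h) / 2 - \<kappa> * (norm h)\<^sup>2 \<le> g (x + h)" by blast
  qed (rule B)
qed

section \<open>Elliptic sets of jets\<close>

lemma symm_inner_commute:
  fixes A :: "real^'n^'n"
  assumes "transpose A = A"
  shows "x \<bullet> (A *v y) = (A *v x) \<bullet> y"
  by (metis assms dot_lmul_matrix vector_transpose_matrix)

lemma eigvals_finite_symm:
  fixes A :: "real^'n^'n"
  assumes A: "transpose A = A"
  shows "finite (eigvals A)"
proof -
  have "\<forall>l\<in>eigvals A. \<exists>v. v \<noteq> 0 \<and> A *v v = l *\<^sub>R v"
    by (auto simp: eigvals_def)
  then obtain e where e: "\<And>l. l \<in> eigvals A \<Longrightarrow> e l \<noteq> 0 \<and> A *v e l = l *\<^sub>R e l"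
    by metis
  have orth: "e l \<bullet> e m = 0" if "l \<in> eigvals A" "m \<in> eigvals A" "l \<noteq> m" for l m
  proof -
    have "l * (e l \<bullet> e m) = m * (e l \<bullet> e m)"
      using symm_inner_commute[OF A, of "e l" "e m"] e that by simp
    with that show ?thesis by simp
  qed
  have inj: "inj_on e (eigvals A)"
    using orth e by (metis inj_onI inner_eq_zero_iff)
  have "pairwise orthogonal (e ` eigvals A)"
    using orth by (auto simp: pairwise_def orthogonal_def)
  then have "independent (e ` eigvals A)"
    by (rule pairwise_orthogonal_independent) (use e in force)
  then have "finite (e ` eigvals A)"
    using independent_bound by blast
  then show ?thesis using inj finite_image_iff by blast
qed

lemma Rayleigh_le_eigval:
  fixes A :: "real^'n^'n"
  assumes A: "transpose A = A"
  obtains l where "l \<in> eigvals A" "\<And>x. x \<bullet> (A *v x) \<le> l * (x \<bullet> x)"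
proof -
  let ?q = "\<lambda>x :: real^'n. x \<bullet> (A *v x)"
  have cont: "continuous_on (sphere 0 1) ?q"
    by (intro continuous_intros linear_continuous_on matrix_vector_mul_bounded_linear)
  obtain b :: "real^'n" where b: "b \<in> Basis" using nonempty_Basis by blast
  then have "b \<in> sphere 0 1" by simp
  then obtain v where v: "v \<in> sphere 0 1" and max: "\<And>x. x \<in> sphere 0 1 \<Longrightarrow> ?q x \<le> ?q v"
    using continuous_attains_sup[OF _ _ cont] by auto
  define l where "l = ?q v"
  have le: "?q x \<le> l * (x \<bullet> x)" for x
  proof (cases "x = 0")
    case False
    define y where "y = (1 / norm x) *\<^sub>R x"
    have xy: "x = norm x *\<^sub>R y" "y \<in> sphere 0 1" using False by (auto simp: y_def)
    have "?q x = (norm x)\<^sup>2 * ?q y"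
      by (subst xy(1), subst (2) xy(1)) (simp add: matrix_vector_mult_scaleR power2_eq_square)
    also have "\<dots> \<le> (norm x)\<^sup>2 * l" using max[OF xy(2)] by (intro mult_left_mono) (auto simp: l_def)
    finally show ?thesis by (simp add: power2_norm_eq_inner mult.commute)
  qed simp
  define w where "w = A *v v - l *\<^sub>R v"
  have vv: "v \<bullet> v = 1" using v by (simp add: dot_square_norm)
  have bl: "bounded_linear ((*v) A)" by (rule matrix_vector_mul_bounded_linear)
  have "(2 *\<^sub>R w) \<bullet> h \<le> (l + onorm ((*v) A)) * (norm h)\<^sup>2" for h
  proof -
    have "?q (v + h) \<le> l * ((v + h) \<bullet> (v + h))" by (rule le)
    then have "2 * (w \<bullet> h) \<le> l * (norm h)\<^sup>2 - ?q h"
      using symm_inner_commute[OF A, of v h] vv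
      by (simp add: w_def l_def matrix_vector_right_distrib inner_diff_left power2_norm_eq_inner
          algebra_simps inner_commute)
    moreover have "- ?q h \<le> onorm ((*v) A) * (norm h)\<^sup>2"
      using Cauchy_Schwarz_ineq2[of h "A *v h"] mult_left_mono[OF onorm[OF bl, of h] norm_ge_zero[of h]]
      by (simp add: power2_eq_square algebra_simps)
    ultimately show ?thesis by (simp add: distrib_right)
  qed
  then have "2 *\<^sub>R w = 0" by (rule eq_0_if_inner_le_quadratic)
  then have "l \<in> eigvals A"
    unfolding eigvals_def using vv by (auto simp: w_def intro!: exI[of _ v])
  with le that show ?thesis by blast
qed

lemma psd_eig_norm_diff:
  fixes A :: "real^'n^'n"
  assumes A: "transpose A = A" and c: "eig_norm A \<le> c"
  shows "psd (c *\<^sub>R mat 1 - A)"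
  unfolding psd_def
proof (intro conjI allI)
  show "transpose (c *\<^sub>R mat 1 - A) = c *\<^sub>R mat 1 - A"
    using A by (simp add: transpose_def vec_eq_iff mat_def)
  fix x :: "real^'n"
  obtain l where l: "l \<in> eigvals A" "\<And>x. x \<bullet> (A *v x) \<le> l * (x \<bullet> x)"
    using Rayleigh_le_eigval[OF A] by blast
  have "\<bar>l\<bar> \<le> eig_norm A"
    unfolding eig_norm_def using eigvals_finite_symm[OF A] l by (intro Max_ge) auto
  then have "l * (x \<bullet> x) \<le> c * (x \<bullet> x)" using c by (intro mult_right_mono) auto
  with l(2)[of x] show "0 \<le> x \<bullet> ((c *\<^sub>R mat 1 - A) *v x)"
    by (simp add: matrix_vector_mult_diff_rdistrib scaleR_matrix_vector_assoc[symmetric] inner_diff_right)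
qed

lemma eigvals_uminus: "eigvals (- A) = uminus ` eigvals A"
proof -
  have "(- A) *v v = - (A *v v)" for v
    by (simp add: matrix_vector_mult_def vec_eq_iff sum_negf)
  then have "l \<in> eigvals (- A) \<longleftrightarrow> - l \<in> eigvals A" for l
    unfolding eigvals_def by (simp add: minus_equation_iff[of "A *v _"]) (metis minus_minus)
  then show ?thesis by (force simp: image_iff minus_equation_iff)
qed

lemma eig_norm_uminus: "eig_norm (- A) = eig_norm A"
  by (simp add: eig_norm_def eigvals_uminus image_image)

lemma eig_norm_scaled_mat_1: "eig_norm (t *\<^sub>R mat 1 :: real^'n^'n) = \<bar>t\<bar>"
proof -
  obtain b :: "real^'n" where b: "b \<in> Basis" using nonempty_Basis by blast
  have "eigvals (t *\<^sub>R mat 1 :: real^'n^'n) = {t}"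
    unfolding eigvals_def using nonzero_Basis[OF b]
    by (auto simp: scaleR_matrix_vector_assoc[symmetric])
  then show ?thesis by (simp add: eig_norm_def)
qed

lemma symm_mats_simps [simp]:
  "A \<in> symm_mats \<Longrightarrow> B \<in> symm_mats \<Longrightarrow> A + B \<in> symm_mats"
  "A \<in> symm_mats \<Longrightarrow> B \<in> symm_mats \<Longrightarrow> A - B \<in> symm_mats"
  "A \<in> symm_mats \<Longrightarrow> c *\<^sub>R A \<in> symm_mats"
  "mat 1 \<in> symm_mats"
  by (auto simp: symm_mats_def transpose_def vec_eq_iff mat_def)

lemma Jspace_simps [simp]:
  "p \<in> Jspace \<Longrightarrow> q \<in> Jspace \<Longrightarrow> p + q \<in> Jspace"
  "p \<in> Jspace \<Longrightarrow> q \<in> Jspace \<Longrightarrow> p - q \<in> Jspace"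
  by (auto simp: Jspace_def mem_Times_iff)

lemma psd_symm: "psd P \<Longrightarrow> P \<in> symm_mats"
  by (simp add: psd_def symm_mats_def)

lemma psd_scaled_mat_1: "0 \<le> c \<Longrightarrow> psd (c *\<^sub>R mat 1)"
  using symm_mats_simps(3)[OF symm_mats_simps(4), of c]
  by (simp add: psd_def symm_mats_def scaleR_matrix_vector_assoc[symmetric])

lemma Qcone_subset_Jspace: "Qcone \<subseteq> Jspace"
  by (auto simp: Qcone_def Jspace_def psd_symm)

text \<open>The direction in which \<open>Qcone\<close> is entered; for sets invariant under \<open>Qcone\<close>, closure, interior and
  Hausdorff distance can be read off from shifts along it.\<close>

definition diag_shift :: "real \<Rightarrow> real \<times> (real^'n^'n)" where
  "diag_shift e = (- e, e *\<^sub>R mat 1)"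

lemma diag_shift_Jspace [simp]: "diag_shift e \<in> Jspace"
  by (simp add: diag_shift_def Jspace_def)

lemma diag_shift_add: "diag_shift a + diag_shift b = diag_shift (a + b)"
  by (simp add: diag_shift_def scaleR_add_left)

lemma diag_shift_Qcone: "0 \<le> e \<Longrightarrow> diag_shift e \<in> Qcone"
  by (simp add: diag_shift_def Qcone_def psd_scaled_mat_1)

lemma jnorm_diag_shift: "jnorm (diag_shift e) = \<bar>e\<bar>"
  by (simp add: jnorm_def diag_shift_def eig_norm_scaled_mat_1)

lemma jnorm_uminus: "jnorm (- p) = jnorm p"
  by (simp add: jnorm_def eig_norm_uminus)

lemma jnorm_commute: "jnorm (p - q) = jnorm (q - p)"
  using jnorm_uminus[of "p - q"] by simp

lemma Qcone_if_jnorm_le: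
  assumes p: "p \<in> Jspace" and e: "jnorm p \<le> e"
  shows "p + diag_shift e \<in> Qcone"
proof -
  have A: "transpose (- snd p) = - snd p"
    using p by (auto simp: Jspace_def symm_mats_def transpose_def vec_eq_iff)
  have "eig_norm (- snd p) \<le> e" using e by (simp add: jnorm_def eig_norm_uminus)
  then have "psd (e *\<^sub>R mat 1 - - snd p)" by (rule psd_eig_norm_diff[OF A])
  with e show ?thesis
    by (cases p) (auto simp: Qcone_def diag_shift_def jnorm_def add.commute)
qed

definition Q_invariant :: "(real \<times> (real^'n^'n)) set \<Rightarrow> bool" where
  "Q_invariant S \<longleftrightarrow> S \<subseteq> Jspace \<and> (\<forall>p\<in>S. \<forall>q\<in>Qcone. p + q \<in> S)"

lemma Q_invariant_Jspace: "Q_invariant Jspace"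
  using Qcone_subset_Jspace Jspace_simps(1) unfolding Q_invariant_def by blast

lemma Q_invariant_near:
  assumes S: "Q_invariant S" and p: "p \<in> S" and q: "q \<in> Jspace" and e: "jnorm (q - p) \<le> e"
  shows "q + diag_shift e \<in> S"
proof -
  have "p \<in> Jspace" using S p by (auto simp: Q_invariant_def)
  then have "q - p + diag_shift e \<in> Qcone" using q e by (intro Qcone_if_jnorm_le) auto
  with S p have "p + (q - p + diag_shift e) \<in> S" unfolding Q_invariant_def by blast
  then show ?thesis by (simp add: algebra_simps)
qed

lemma int_J_iff_diag_shift:
  assumes S: "Q_invariant S" and p: "p \<in> Jspace"
  shows "p \<in> int_J S \<longleftrightarrow> (\<exists>e>0. p - diag_shift e \<in> S)"
proof
  assume "p \<in> int_J S"
  then obtain e where e: "0 < e" "\<And>q. q \<in> Jspace \<Longrightarrow> jnorm (q - p) < e \<Longrightarrow> q \<in> S"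
    by (auto simp: int_J_def)
  have "jnorm (p - diag_shift (e / 2) - p) < e"
    using e by (simp add: jnorm_uminus jnorm_diag_shift)
  with e p have "p - diag_shift (e / 2) \<in> S" by auto
  with e show "\<exists>e>0. p - diag_shift e \<in> S" by (intro exI[of _ "e / 2"]) auto
next
  assume "\<exists>e>0. p - diag_shift e \<in> S"
  then obtain e where e: "0 < e" "p - diag_shift e \<in> S" by auto
  have "p \<in> S"
    using S e diag_shift_Qcone[of e] unfolding Q_invariant_def
    by (metis diff_add_cancel less_imp_le)
  moreover have "q \<in> S" if q: "q \<in> Jspace" "jnorm (q - p) < e" for q
  proof -
    have "(q - diag_shift e) + diag_shift e \<in> S"
      by (rule Q_invariant_near[OF S e(2)]) (use q in auto)
    then show ?thesis by simp
  qed
  ultimately show "p \<in> int_J S"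
    unfolding int_J_def using e by blast
qed

lemma int_J_mono: "S \<subseteq> T \<Longrightarrow> int_J S \<subseteq> int_J T"
  unfolding int_J_def by blast

lemma closure_J_mono: "S \<subseteq> T \<Longrightarrow> closure_J S \<subseteq> closure_J T"
  unfolding closure_J_def by blast

lemma subset_closure_J:
  assumes "S \<subseteq> Jspace"
  shows "S \<subseteq> closure_J S"
proof
  fix p assume p: "p \<in> S"
  have "jnorm (p - p) = 0" using jnorm_diag_shift[of 0] by (simp add: diag_shift_def zero_prod_def)
  with p assms show "p \<in> closure_J S" by (auto simp: closure_J_def intro!: bexI[of _ p])
qed

lemma diag_shift_if_hdist_less:
  assumes T: "Q_invariant T" and S: "S \<subseteq> Jspace" and d: "hdist_J S T < ereal \<eta>" and p: "p \<in> S"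
  shows "p + diag_shift \<eta> \<in> T"
proof -
  have "(INF t\<in>T. ereal (jnorm (p - t))) \<le> hdist_J S T"
    unfolding hdist_J_def using p by (intro max.coboundedI1 SUP_upper)
  then have "(INF t\<in>T. ereal (jnorm (p - t))) < ereal \<eta>" using d by order
  then obtain t where t: "t \<in> T" "jnorm (p - t) < \<eta>" by (auto simp: INF_less_iff)
  show ?thesis
    by (rule Q_invariant_near[OF T t(1)]) (use p S t in auto)
qed

lemma hdist_J_commute: "hdist_J S T = hdist_J T S"
  by (simp add: hdist_J_def max.commute)

lemma hdist_le_if_diag_shift:
  assumes \<eta>: "0 \<le> \<eta>"
    and ST: "\<And>p. p \<in> S \<Longrightarrow> p + diag_shift \<eta> \<in> T" and TS: "\<And>p. p \<in> T \<Longrightarrow> p + diag_shift \<eta> \<in> S"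
  shows "hdist_J S T \<le> ereal \<eta>"
proof -
  have *: "(SUP s\<in>S. INF t\<in>T. ereal (jnorm (s - t))) \<le> ereal \<eta>"
    if "\<And>p. p \<in> S \<Longrightarrow> p + diag_shift \<eta> \<in> T" for S T :: "(real \<times> (real^'n^'n)) set"
  proof (rule SUP_least)
    fix s assume "s \<in> S"
    then have "(INF t\<in>T. ereal (jnorm (s - t))) \<le> ereal (jnorm (s - (s + diag_shift \<eta>)))"
      using that by (intro INF_lower) auto
    also have "jnorm (s - (s + diag_shift \<eta>)) = \<eta>"
      using \<eta> by (simp add: jnorm_uminus jnorm_diag_shift)
    finally show "(INF t\<in>T. ereal (jnorm (s - t))) \<le> ereal \<eta>" .
  qed
  show ?thesis unfolding hdist_J_def using *[OF ST] *[OF TS] by simp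
qed

section \<open>The comparison principle\<close>

lemma usc_on_attains_max:
  assumes "compact S" "S \<noteq> {}" and u: "usc_on S u"
  obtains x where "x \<in> S" "\<And>y. y \<in> S \<Longrightarrow> u y \<le> u x"
proof (rule ccontr)
  assume "\<not> thesis"
  then have "\<exists>y\<in>S. u x < u y" if "x \<in> S" for x
    using that \<open>\<And>x. x \<in> S \<Longrightarrow> (\<And>y. y \<in> S \<Longrightarrow> u y \<le> u x) \<Longrightarrow> thesis\<close> by (meson not_le)
  then obtain m where m: "\<And>x. x \<in> S \<Longrightarrow> m x \<in> S \<and> u x < u (m x)" by metis
  then have "\<exists>e>0. \<forall>y\<in>S. dist y x < e \<longrightarrow> u y < u (m x)" if "x \<in> S" for x
    using u that unfolding usc_on_def by blast
  then obtain e where e: "\<And>x. x \<in> S \<Longrightarrow> 0 < e x \<and> (\<forall>y\<in>S. dist y x < e x \<longrightarrow> u y < u (m x))"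
    by metis
  have "S \<subseteq> (\<Union>x\<in>S. ball x (e x))" using e by force
  then obtain D where D: "D \<subseteq> S" "finite D" "S \<subseteq> (\<Union>x\<in>D. ball x (e x))"
    using compactE_image[OF \<open>compact S\<close>, of S "\<lambda>x. ball x (e x)"] by auto
  then have "D \<noteq> {}" using \<open>S \<noteq> {}\<close> by auto
  define M where "M = Max ((\<lambda>x. u (m x)) ` D)"
  have "M \<in> (\<lambda>x. u (m x)) ` D" unfolding M_def using D \<open>D \<noteq> {}\<close> by (intro Max_in) auto
  then obtain x where x: "x \<in> D" "M = u (m x)" by auto
  then have "m x \<in> S" using D m by auto
  then obtain y where y: "y \<in> D" "m x \<in> ball y (e y)" using D by auto
  then have "u (m x) < u (m y)" using e[of y] D \<open>m x \<in> S\<close> by (auto simp: dist_commute)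
  also have "\<dots> \<le> M" unfolding M_def using D y by (intro Max_ge) auto
  finally show False using x by simp
qed

lemma usc_on_uminus_iff: "usc_on S (\<lambda>x. - v x) \<longleftrightarrow> lsc_on S v"
proof
  assume *: "usc_on S (\<lambda>x. - v x)"
  show "lsc_on S v"
    unfolding lsc_on_def
  proof (intro ballI allI impI)
    fix x a assume "x \<in> S" "a < v x"
    then show "\<exists>e>0. \<forall>y\<in>S. dist y x < e \<longrightarrow> a < v y"
      using *[unfolded usc_on_def, rule_format, of x "- a"] by simp
  qed
next
  assume *: "lsc_on S v"
  show "usc_on S (\<lambda>x. - v x)"
    unfolding usc_on_def
  proof (intro ballI allI impI)
    fix x a assume "x \<in> S" "- v x < a"
    then show "\<exists>e>0. \<forall>y\<in>S. dist y x < e \<longrightarrow> - v y < a"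
      using *[unfolded lsc_on_def, rule_format, of x "- a"] by (simp add: minus_less_iff)
  qed
qed

lemma usc_on_add_continuous:
  assumes u: "usc_on S u" and q: "continuous_on S q"
  shows "usc_on S (\<lambda>x. u x + q x)"
  unfolding usc_on_def
proof (intro ballI allI impI)
  fix x a assume x: "x \<in> S" and a: "u x + q x < a"
  define \<epsilon> where "\<epsilon> = (a - (u x + q x)) / 2"
  have \<epsilon>: "0 < \<epsilon>" using a by (simp add: \<epsilon>_def)
  obtain e1 where e1: "e1 > 0" "\<forall>y\<in>S. dist y x < e1 \<longrightarrow> u y < u x + \<epsilon>"
    using u x \<epsilon> unfolding usc_on_def by (metis less_add_same_cancel1)
  obtain e2 where e2: "e2 > 0" "\<forall>y\<in>S. dist y x < e2 \<longrightarrow> dist (q y) (q x) < \<epsilon>"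
    using q x \<epsilon> unfolding continuous_on_iff by metis
  have "u y + q y < a" if "y \<in> S" "dist y x < min e1 e2" for y
  proof -
    have "u y < u x + \<epsilon>" "\<bar>q y - q x\<bar> < \<epsilon>" using that e1 e2 by (auto simp: dist_real_def)
    moreover have "2 * \<epsilon> = a - (u x + q x)" by (simp add: \<epsilon>_def)
    ultimately show ?thesis by linarith
  qed
  with e1 e2 show "\<exists>e>0. \<forall>y\<in>S. dist y x < e \<longrightarrow> u y + q y < a"
    by (intro exI[of _ "min e1 e2"]) auto
qed

lemma sup_convolution_attained:
  fixes u :: "real^'n \<Rightarrow> real"
  assumes S: "compact S" "S \<noteq> {}" and u: "usc_on S u"
  obtains \<xi> f where "\<And>x. \<xi> x \<in> S" "\<And>x. f x = u (\<xi> x) - C * (norm (x - \<xi> x))\<^sup>2"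
    "\<And>x y. y \<in> S \<Longrightarrow> u y - C * (norm (x - y))\<^sup>2 \<le> f x"
proof -
  have "\<exists>z\<in>S. \<forall>y\<in>S. u y - C * (norm (x - y))\<^sup>2 \<le> u z - C * (norm (x - z))\<^sup>2" for x
  proof -
    have "usc_on S (\<lambda>y. u y + - (C * (norm (x - y))\<^sup>2))"
      using u by (rule usc_on_add_continuous) (intro continuous_intros)
    then show ?thesis by (rule usc_on_attains_max[OF S]) auto
  qed
  then obtain \<xi> where "\<And>x. \<xi> x \<in> S \<and> (\<forall>y\<in>S. u y - C * (norm (x - y))\<^sup>2 \<le> u (\<xi> x) - C * (norm (x - \<xi> x))\<^sup>2)"
    by metis
  then show ?thesis
    using that[of \<xi> "\<lambda>x. u (\<xi> x) - C * (norm (x - \<xi> x))\<^sup>2"] by blast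
qed

lemma C2_on_with_quadratic:
  fixes X :: "real^'n^'n"
  assumes "open U" and X: "X \<in> symm_mats"
  shows "C2_on_with U (\<lambda>z. c + p \<bullet> (z - x) + ((z - x) \<bullet> (X *v (z - x))) / 2) (\<lambda>z. p + X *v (z - x)) (\<lambda>_. X)"
proof -
  have bl: "bounded_linear ((*v) X)" by (rule matrix_vector_mul_bounded_linear)
  have D0: "((\<lambda>z. z - x) has_derivative (\<lambda>h. h)) (at z)" for z
    by (auto intro!: derivative_eq_intros)
  have D: "((\<lambda>z. X *v (z - x)) has_derivative (\<lambda>h. X *v h)) (at z)" for z
    by (rule bounded_linear.has_derivative[OF bl D0])
  have "((\<lambda>z. c + p \<bullet> (z - x) + ((z - x) \<bullet> (X *v (z - x))) / 2) has_derivative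
      (\<lambda>h. 0 + p \<bullet> h + ((z - x) \<bullet> (X *v h) + h \<bullet> (X *v (z - x))) / 2)) (at z)" for z
    by (intro has_derivative_add has_derivative_const D0
        bounded_linear.has_derivative[OF bounded_linear_inner_right]
        bounded_linear.has_derivative[OF bounded_linear_divide] has_derivative_inner[OF D0 D])
  moreover have "(\<lambda>h. 0 + p \<bullet> h + ((z - x) \<bullet> (X *v h) + h \<bullet> (X *v (z - x))) / 2) =
      (\<lambda>h. (p + X *v (z - x)) \<bullet> h)" for z
    using X symm_inner_commute[of X "z - x"] by (auto simp: symm_mats_def inner_add_left inner_commute[of _ "X *v (z - x)"])
  moreover have "((\<lambda>z. p + X *v (z - x)) has_derivative (\<lambda>h. X *v h)) (at z)" for z
    using has_derivative_add[OF has_derivative_const[of p] D] by simp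
  ultimately show ?thesis
    using \<open>open U\<close> unfolding C2_on_with_def by (auto intro: continuous_on_const)
qed

lemma jet_plus_quadraticI:
  fixes X :: "real^'n^'n"
  assumes X: "X \<in> symm_mats" and "0 < d"
    and le: "\<And>h. norm h < d \<Longrightarrow> u (x + h) \<le> u x + p \<bullet> h + (h \<bullet> (X *v h)) / 2"
  shows "(u x, X) \<in> jet_plus u x"
proof -
  let ?\<phi> = "\<lambda>z. u x + p \<bullet> (z - x) + ((z - x) \<bullet> (X *v (z - x))) / 2"
  have "\<forall>z\<in>ball x d. u z \<le> ?\<phi> z"
    using le[of "z - x" for z] by (auto simp: dist_norm norm_minus_commute)
  moreover have "C2_on_with (ball x d) ?\<phi> (\<lambda>z. p + X *v (z - x)) (\<lambda>_. X)"
    using X by (intro C2_on_with_quadratic) auto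
  ultimately show ?thesis
    unfolding jet_plus_def mem_Collect_eq using \<open>0 < d\<close>
    by (intro exI[of _ ?\<phi>] exI[of _ "\<lambda>z. p + X *v (z - x)"] exI[of _ "\<lambda>_. X"] exI[of _ "ball x d"]) auto
qed

lemma jet_minus_quadraticI:
  fixes X :: "real^'n^'n"
  assumes X: "X \<in> symm_mats" and "0 < d"
    and le: "\<And>h. norm h < d \<Longrightarrow> v x + p \<bullet> h + (h \<bullet> (X *v h)) / 2 \<le> v (x + h)"
  shows "(v x, X) \<in> jet_minus v x"
proof -
  let ?\<phi> = "\<lambda>z. v x + p \<bullet> (z - x) + ((z - x) \<bullet> (X *v (z - x))) / 2"
  have "\<forall>z\<in>ball x d. ?\<phi> z \<le> v z"
    using le[of "z - x" for z] by (auto simp: dist_norm norm_minus_commute)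
  moreover have "C2_on_with (ball x d) ?\<phi> (\<lambda>z. p + X *v (z - x)) (\<lambda>_. X)"
    using X by (intro C2_on_with_quadratic) auto
  ultimately show ?thesis
    unfolding jet_minus_def mem_Collect_eq using \<open>0 < d\<close>
    by (intro exI[of _ ?\<phi>] exI[of _ "\<lambda>z. p + X *v (z - x)"] exI[of _ "\<lambda>_. X"] exI[of _ "ball x d"]) auto
qed

lemma proper_elliptic_map_Q_invariant:
  "proper_elliptic_map \<Omega> \<Theta> \<Longrightarrow> x \<in> \<Omega> \<Longrightarrow> Q_invariant (\<Theta> x)"
  by (auto simp: proper_elliptic_map_def Q_invariant_def closed_J_def)

lemma hausdorff_continuous_uniform_shift:
  fixes \<Theta> :: "real^'n \<Rightarrow> (real \<times> (real^'n^'n)) set"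
  assumes \<Theta>: "proper_elliptic_map \<Omega> \<Theta>" "hausdorff_continuous \<Omega> \<Theta>"
    and K: "compact K" "K \<subseteq> \<Omega>" and \<eta>: "0 < \<eta>"
  obtains \<delta> where "0 < \<delta>"
    "\<And>x y p. x \<in> K \<Longrightarrow> y \<in> \<Omega> \<Longrightarrow> dist x y < \<delta> \<Longrightarrow> p \<in> \<Theta> x \<Longrightarrow> p + diag_shift \<eta> \<in> \<Theta> y"
proof -
  have inv: "Q_invariant (\<Theta> x)" if "x \<in> \<Omega>" for x
    using \<Theta>(1) that by (rule proper_elliptic_map_Q_invariant)
  have "\<exists>\<delta>>0. \<forall>y\<in>\<Omega>. dist z y < \<delta> \<longrightarrow> hdist_J (\<Theta> z) (\<Theta> y) < ereal (\<eta> / 2)" if "z \<in> K" for z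
    using \<Theta>(2) that K \<eta> unfolding hausdorff_continuous_def by (meson half_gt_zero subsetD)
  then obtain \<delta> where \<delta>: "\<And>z. z \<in> K \<Longrightarrow> 0 < \<delta> z \<and>
      (\<forall>y\<in>\<Omega>. dist z y < \<delta> z \<longrightarrow> hdist_J (\<Theta> z) (\<Theta> y) < ereal (\<eta> / 2))"
    by metis
  have "K \<subseteq> \<Union> ((\<lambda>z. ball z (\<delta> z)) ` K)" using \<delta> by force
  then obtain e where e: "0 < e" "\<And>x. x \<in> K \<Longrightarrow> \<exists>G\<in>(\<lambda>z. ball z (\<delta> z)) ` K. ball x e \<subseteq> G"
    by (rule Heine_Borel_lemma[OF K(1)]) auto
  show ?thesis
  proof
    fix x y p assume x: "x \<in> K" and y: "y \<in> \<Omega>" and xy: "dist x y < e" and p: "p \<in> \<Theta> x"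
    obtain z where z: "z \<in> K" "ball x e \<subseteq> ball z (\<delta> z)" using e x by blast
    have \<Omega>: "x \<in> \<Omega>" "z \<in> \<Omega>" using x z K by auto
    have "x \<in> ball z (\<delta> z)" "y \<in> ball z (\<delta> z)" using subsetD[OF z(2), of x] subsetD[OF z(2), of y] xy e(1) by auto
    then have h: "hdist_J (\<Theta> x) (\<Theta> z) < ereal (\<eta> / 2)" "hdist_J (\<Theta> z) (\<Theta> y) < ereal (\<eta> / 2)"
      using \<delta>[OF z(1)] y \<Omega> by (auto simp: hdist_J_commute[of "\<Theta> x"])
    have "p + diag_shift (\<eta> / 2) \<in> \<Theta> z"
      using inv[OF \<Omega>(2)] _ h(1) p by (rule diag_shift_if_hdist_less) (use inv[OF \<Omega>(1)] in \<open>simp add: Q_invariant_def\<close>)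
    then have "p + diag_shift (\<eta> / 2) + diag_shift (\<eta> / 2) \<in> \<Theta> y"
      using inv[OF \<Omega>(2)] by (intro diag_shift_if_hdist_less[OF inv[OF y] _ h(2)]) (simp_all add: Q_invariant_def)
    then show "p + diag_shift \<eta> \<in> \<Theta> y" by (simp add: add.assoc diag_shift_add)
  qed (rule e)
qed

lemma near_maxima_in_compact_subset:
  fixes u v :: "real^'n \<Rightarrow> real"
  assumes \<Omega>: "bounded \<Omega>" "open \<Omega>"
    and u: "usc_on (closure \<Omega>) u" and v: "lsc_on (closure \<Omega>) v"
    and bdry: "\<And>x. x \<in> frontier \<Omega> \<Longrightarrow> u x \<le> v x" and m: "0 < m"
  obtains K d where "compact K" "K \<subseteq> \<Omega>" "0 < d"
    "\<And>x y. x \<in> closure \<Omega> \<Longrightarrow> y \<in> closure \<Omega> \<Longrightarrow> dist x y < d \<Longrightarrow> m \<le> u x - v y \<Longrightarrow> x \<in> K \<and> y \<in> K"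
proof -
  have sub: "frontier \<Omega> \<subseteq> closure \<Omega>" by (simp add: frontier_def)
  have "\<exists>e>0. \<forall>x\<in>closure \<Omega>. \<forall>y\<in>closure \<Omega>. dist x z < e \<longrightarrow> dist y z < e \<longrightarrow> u x - v y < m"
    if z: "z \<in> frontier \<Omega>" for z
  proof -
    have zc: "z \<in> closure \<Omega>" using z sub by auto
    obtain e1 where e1: "e1 > 0" "\<forall>x\<in>closure \<Omega>. dist x z < e1 \<longrightarrow> u x < u z + m / 2"
      using u[unfolded usc_on_def, rule_format, OF zc, of "u z + m / 2"] m by auto
    obtain e2 where e2: "e2 > 0" "\<forall>y\<in>closure \<Omega>. dist y z < e2 \<longrightarrow> v z - m / 2 < v y"
      using v[unfolded lsc_on_def, rule_format, OF zc, of "v z - m / 2"] m by auto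
    have "u x - v y < m" if "x \<in> closure \<Omega>" "y \<in> closure \<Omega>" "dist x z < min e1 e2" "dist y z < min e1 e2" for x y
    proof -
      have "u x < u z + m / 2" "v z - m / 2 < v y" using that e1 e2 by auto
      with bdry[OF z] show ?thesis by linarith
    qed
    with e1 e2 show ?thesis by (intro exI[of _ "min e1 e2"]) auto
  qed
  then obtain r where r: "\<And>z. z \<in> frontier \<Omega> \<Longrightarrow> 0 < r z \<and>
      (\<forall>x\<in>closure \<Omega>. \<forall>y\<in>closure \<Omega>. dist x z < r z \<longrightarrow> dist y z < r z \<longrightarrow> u x - v y < m)"
    by metis
  have "frontier \<Omega> \<subseteq> \<Union> ((\<lambda>z. ball z (r z)) ` frontier \<Omega>)" using r by force
  then obtain e where e: "0 < e" "\<And>x. x \<in> frontier \<Omega> \<Longrightarrow> \<exists>G\<in>(\<lambda>z. ball z (r z)) ` frontier \<Omega>. ball x e \<subseteq> G"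
    by (rule Heine_Borel_lemma[OF compact_frontier_bounded[OF \<Omega>(1)]]) auto
  have far: "u x - v y < m" if xy: "x \<in> closure \<Omega>" "y \<in> closure \<Omega>" and z: "z \<in> frontier \<Omega>" "dist z x < e" "dist z y < e" for x y z
  proof -
    obtain z' where z': "z' \<in> frontier \<Omega>" "ball z e \<subseteq> ball z' (r z')" using e z by blast
    then have "x \<in> ball z' (r z')" "y \<in> ball z' (r z')" using z by auto
    then show ?thesis using r[OF z'(1)] xy by (auto simp: dist_commute)
  qed
  define K where "K = closure \<Omega> - (\<Union>z\<in>frontier \<Omega>. ball z (e / 2))"
  show ?thesis
  proof
    show "compact K" unfolding K_def using \<Omega> by (intro compact_diff) (auto simp: compact_closure)
    show "K \<subseteq> \<Omega>"
      unfolding K_def using e \<Omega> by (force simp: frontier_def interior_open)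
    show "0 < e / 2" using e by simp
    fix x y assume xy: "x \<in> closure \<Omega>" "y \<in> closure \<Omega>" "dist x y < e / 2" "m \<le> u x - v y"
    have "e / 2 \<le> dist z x \<and> e / 2 \<le> dist z y" if z: "z \<in> frontier \<Omega>" for z
    proof (rule ccontr)
      assume "\<not> (e / 2 \<le> dist z x \<and> e / 2 \<le> dist z y)"
      then have "dist z x < e \<and> dist z y < e"
        using xy(3) dist_triangle[of z y x] dist_triangle2[of z x y] e by (auto simp: not_le dist_commute)
      with far[OF xy(1,2) z] xy(4) show False by linarith
    qed
    then show "x \<in> K \<and> y \<in> K" using xy by (auto simp: K_def not_less)
  qed
qed

lemma sup_convolution_paraboloid_below:
  fixes u f :: "real^'n \<Rightarrow> real"
  assumes w: "w \<in> S" and f: "f x = u (w) - C * (norm (x - w))\<^sup>2"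
    and le: "\<And>z y. y \<in> S \<Longrightarrow> u y - C * (norm (z - y))\<^sup>2 \<le> f z"
  shows "\<exists>a. \<forall>z. f x + a \<bullet> (z - x) - C * (norm (z - x))\<^sup>2 \<le> f z"
proof (intro exI[of _ "(2 * C) *\<^sub>R (w - x)"] allI)
  fix z
  have "f x + ((2 * C) *\<^sub>R (w - x)) \<bullet> (z - x) - C * (norm (z - x))\<^sup>2 = u (w) - C * (norm (z - w))\<^sup>2"
    unfolding f power2_norm_eq_inner by (simp add: algebra_simps inner_commute)
  also have "\<dots> \<le> f z" using w by (rule le)
  finally show "f x + ((2 * C) *\<^sub>R (w - x)) \<bullet> (z - x) - C * (norm (z - x))\<^sup>2 \<le> f z" .
qed

theorem comparison_elliptic_map:
  fixes \<Theta> :: "real^'n \<Rightarrow> (real \<times> (real^'n^'n)) set"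
  assumes \<Omega>: "bounded \<Omega>" "open \<Omega>"
    and \<Theta>: "proper_elliptic_map \<Omega> \<Theta>" "hausdorff_continuous \<Omega> \<Theta>"
    and u: "usc_on (closure \<Omega>) u" and v: "lsc_on (closure \<Omega>) v"
    and sub: "\<And>x. x \<in> \<Omega> \<Longrightarrow> jet_plus u x \<subseteq> \<Theta> x"
    and super: "\<And>x. x \<in> \<Omega> \<Longrightarrow> jet_minus v x \<inter> int_J (\<Theta> x) = {}"
    and bdry: "\<And>x. x \<in> frontier \<Omega> \<Longrightarrow> u x \<le> v x"
    and x0: "x0 \<in> \<Omega>"
  shows "u x0 \<le> v x0"
proof (rule ccontr)
  assume "\<not> u x0 \<le> v x0"
  define S where "S = closure \<Omega>"
  have S: "compact S" "S \<noteq> {}" "x0 \<in> S"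
    using \<Omega> x0 closure_subset by (auto simp: S_def compact_closure)
  obtain R where R: "0 < R" "\<And>x. x \<in> S \<Longrightarrow> norm x \<le> R"
    using compact_imp_bounded[OF S(1)] bounded_pos by blast
  define m where "m = (u x0 - v x0) / 2"
  have m: "0 < m" using \<open>\<not> u x0 \<le> v x0\<close> by (simp add: m_def)
  define \<theta> where "\<theta> = 2 * m / R\<^sup>2"
  have \<theta>: "0 < \<theta>" "\<theta> / 2 * R\<^sup>2 = m" using m R by (auto simp: \<theta>_def)
  define \<kappa> where "\<kappa> = min (\<theta> / 6) (m / 4)"
  have \<kappa>: "0 < \<kappa>" "6 * \<kappa> \<le> \<theta>" "4 * \<kappa> \<le> m" using \<theta> m by (auto simp: \<kappa>_def)
  define u' where "u' x = u x + \<theta> / 2 * ((norm x)\<^sup>2 - R\<^sup>2)" for x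
  have u'_le: "u' x \<le> u x" if "x \<in> S" for x
  proof -
    have "(norm x)\<^sup>2 \<le> R\<^sup>2" using R that by (intro power_mono) auto
    then show ?thesis using \<theta> by (simp add: u'_def mult_nonneg_nonpos)
  qed
  have u': "usc_on S u'"
    unfolding u'_def S_def using u by (rule usc_on_add_continuous) (intro continuous_intros)
  have gap: "m \<le> u' x0 - v x0"
  proof -
    have "0 \<le> \<theta> / 2 * (norm x0)\<^sup>2" using \<theta> by simp
    moreover have "u' x0 = u x0 + \<theta> / 2 * (norm x0)\<^sup>2 - m"
      using \<theta>(2) by (simp add: u'_def right_diff_distrib)
    moreover have "u x0 - v x0 = 2 * m" by (simp add: m_def)
    ultimately show ?thesis by linarith
  qed
  have v': "usc_on S (\<lambda>x. - v x)" using v by (simp add: usc_on_uminus_iff S_def)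
  have "frontier \<Omega> \<subseteq> S" by (simp add: S_def frontier_def)
  then have bdry': "u' x \<le> v x" if "x \<in> frontier \<Omega>" for x
    using u'_le[of x] bdry[OF that] that by auto
  have m2: "0 < m / 2" using m by simp
  obtain K d where K: "compact K" "K \<subseteq> \<Omega>" and d: "0 < d"
    and inK: "\<And>x y. x \<in> S \<Longrightarrow> y \<in> S \<Longrightarrow> dist x y < d \<Longrightarrow> m / 2 \<le> u' x - v y \<Longrightarrow> x \<in> K \<and> y \<in> K"
    using near_maxima_in_compact_subset[OF \<Omega> u'[unfolded S_def] v bdry' m2] unfolding S_def by blast
  obtain \<delta> where \<delta>: "0 < \<delta>" "\<And>x y p. x \<in> K \<Longrightarrow> y \<in> \<Omega> \<Longrightarrow> dist x y < \<delta> \<Longrightarrow> p \<in> \<Theta> x \<Longrightarrow> p + diag_shift \<kappa> \<in> \<Theta> y"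
    using hausdorff_continuous_uniform_shift[OF \<Theta> K \<kappa>(1)] by blast
  obtain xu where xu: "xu \<in> S" "\<And>x. x \<in> S \<Longrightarrow> u' x \<le> u' xu"
    using usc_on_attains_max[OF S(1,2) u'] by blast
  obtain xv where xv: "xv \<in> S" "\<And>x. x \<in> S \<Longrightarrow> - v x \<le> - v xv"
    using usc_on_attains_max[OF S(1,2) v'] by blast
  define D where "D = u' xu - v xv"
  have D: "0 < D" "\<And>x y. x \<in> S \<Longrightarrow> y \<in> S \<Longrightarrow> u' x - v y \<le> D"
  proof -
    show le: "u' x - v y \<le> D" if "x \<in> S" "y \<in> S" for x y
      using xu(2)[OF that(1)] xv(2)[OF that(2)] by (simp add: D_def)
    show "0 < D" using le[OF S(3) S(3)] gap m by linarith
  qed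
  define \<rho> where "\<rho> = min d \<delta>"
  have \<rho>: "0 < \<rho>" "\<rho> \<le> d" "\<rho> \<le> \<delta>" using d \<delta> by (auto simp: \<rho>_def)
  define C where "C = 5 * D / \<rho>\<^sup>2"
  have C: "0 < C" "C * \<rho>\<^sup>2 = 5 * D" using D \<rho> by (auto simp: C_def)
  obtain \<xi> f where \<xi>: "\<And>x. \<xi> x \<in> S" and f: "\<And>x. f x = u' (\<xi> x) - C * (norm (x - \<xi> x))\<^sup>2"
    and f_ge: "\<And>x y. y \<in> S \<Longrightarrow> u' y - C * (norm (x - y))\<^sup>2 \<le> f x"
    by (rule sup_convolution_attained[OF S(1,2) u', where C = C]) (rule that)
  obtain \<zeta> g' where \<zeta>: "\<And>x. \<zeta> x \<in> S" and g': "\<And>x. g' x = - v (\<zeta> x) - C * (norm (x - \<zeta> x))\<^sup>2"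
    and g'_ge: "\<And>x y. y \<in> S \<Longrightarrow> - v y - C * (norm (x - y))\<^sup>2 \<le> g' x"
    by (rule sup_convolution_attained[OF S(1,2) v', where C = C]) (rule that)
  define g where "g x = - g' x" for x
  have W: "f x - g x = u' (\<xi> x) - v (\<zeta> x) - C * (norm (x - \<xi> x))\<^sup>2 - C * (norm (x - \<zeta> x))\<^sup>2" for x
    by (simp add: g_def f g')
  have Cn: "0 \<le> C * (norm y)\<^sup>2" for y :: "real^'n" using C by simp
  have W0: "m \<le> f x0 - g x0"
    using f_ge[OF S(3), of x0] g'_ge[OF S(3), of x0] gap by (simp add: g_def)
  have near: "norm (x - \<xi> x) < \<rho> / 2 \<and> norm (x - \<zeta> x) < \<rho> / 2 \<and> m / 2 \<le> u' (\<xi> x) - v (\<zeta> x)"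
    if x: "m / 2 \<le> f x - g x" for x
  proof -
    have small: "norm y < \<rho> / 2" if "C * (norm y)\<^sup>2 \<le> D" for y :: "real^'n"
    proof (rule power_less_imp_less_base)
      have "C * (norm y)\<^sup>2 < C * (\<rho> / 2)\<^sup>2" using that C(2) D(1) by (simp add: power_divide)
      then show "(norm y)\<^sup>2 < (\<rho> / 2)\<^sup>2" using C(1) by simp
      show "0 \<le> \<rho> / 2" using \<rho> by simp
    qed
    have "C * (norm (x - \<xi> x))\<^sup>2 \<le> D" "C * (norm (x - \<zeta> x))\<^sup>2 \<le> D"
      using x W[of x] D(2)[OF \<xi>[of x] \<zeta>[of x]] Cn[of "x - \<xi> x"] Cn[of "x - \<zeta> x"] m by linarith+
    with small x W[of x] Cn[of "x - \<xi> x"] Cn[of "x - \<zeta> x"] show ?thesis by auto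
  qed
  define s where "s = max 1 ((D + 2 * R + 1) / C)"
  have decay: "f x - g x \<le> f x0 - g x0 - norm (x - x0)" if x: "2 * R + s \<le> norm (x - x0)" for x
  proof -
    define t where "t = norm (x - x0) - 2 * R"
    have t: "1 \<le> t" "(D + 2 * R + 1) / C \<le> t" using x by (auto simp: t_def s_def)
    have "norm (x - x0) \<le> norm (x - \<xi> x) + norm (\<xi> x - x0)"
      using norm_triangle_ineq[of "x - \<xi> x" "\<xi> x - x0"] by simp
    also have "norm (\<xi> x - x0) \<le> 2 * R"
      using norm_triangle_ineq4[of "\<xi> x" x0] R(2)[OF \<xi>[of x]] R(2)[OF S(3)] by linarith
    finally have "t \<le> norm (x - \<xi> x)" by (simp add: t_def)
    then have "C * (t * t) \<le> C * (norm (x - \<xi> x))\<^sup>2"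
      using C t by (auto simp: power2_eq_square intro!: mult_mono)
    moreover have "D + 2 * R + 1 \<le> C * t" using t C by (simp add: field_simps)
    then have "(D + 2 * R + 1) * t \<le> C * t * t" using t by (intro mult_right_mono) auto
    moreover have "(D + 2 * R) * 1 \<le> (D + 2 * R) * t" using t D(1) R(1) by (intro mult_left_mono) auto
    ultimately have "D + 2 * R + t \<le> C * (norm (x - \<xi> x))\<^sup>2" by (simp add: algebra_simps)
    then show ?thesis
      using W[of x] D(2)[OF \<xi>[of x] \<zeta>[of x]] Cn[of "x - \<zeta> x"] W0 m by (simp add: t_def)
  qed
  have fpar: "\<exists>a. \<forall>z. f x + a \<bullet> (z - x) - C * (norm (z - x))\<^sup>2 \<le> f z" for x
    by (rule sup_convolution_paraboloid_below[where u = u', OF \<xi>[of x] f[of x] f_ge])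
  have gpar: "\<exists>a. \<forall>z. g z \<le> g x + a \<bullet> (z - x) + C * (norm (z - x))\<^sup>2" for x
  proof -
    obtain a where "\<And>z. g' x + a \<bullet> (z - x) - C * (norm (z - x))\<^sup>2 \<le> g' z"
      using sup_convolution_paraboloid_below[where u = "\<lambda>x. - v x" and f = g' and x = x, OF \<zeta>[of x] g'[of x] g'_ge] by blast
    then show ?thesis by (intro exI[of _ "- a"]) (auto simp: g_def algebra_simps)
  qed
  obtain x p q B where xW: "f x0 - g x0 - m / 2 \<le> f x - g x" and B: "bounded_linear B"
    and expand: "\<And>\<kappa>. 0 < \<kappa> \<Longrightarrow> \<exists>d>0. \<forall>h. norm h < d \<longrightarrow>
        f (x + h) \<le> f x + p \<bullet> h + (h \<bullet> B h) / 2 + \<kappa> * (norm h)\<^sup>2 \<and>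
        g x + q \<bullet> h + (h \<bullet> B h) / 2 - \<kappa> * (norm h)\<^sup>2 \<le> g (x + h)"
    by (rule semiconvex_difference_second_order[where R = "2 * R + s", OF less_imp_le[OF C(1)] fpar gpar _ m2],
        erule decay, rule that)
  define a b where "a = \<xi> x" and "b = \<zeta> x"
  have "m / 2 \<le> f x - g x" using xW W0 by linarith
  from near[OF this] have na: "norm (x - a) < \<rho> / 2" and nb: "norm (x - b) < \<rho> / 2" and ab: "m / 2 \<le> u' a - v b"
    by (auto simp: a_def b_def)
  have dab: "dist a b < \<rho>"
    using norm_triangle_ineq4[of "x - b" "x - a"] na nb by (simp add: dist_norm)
  have SS: "a \<in> S" "b \<in> S" by (simp_all add: a_def b_def \<xi> \<zeta>)
  have "a \<in> K \<and> b \<in> K" using inK[OF SS] dab ab \<rho> by auto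
  then have abK: "a \<in> K" "b \<in> K" "a \<in> \<Omega>" "b \<in> \<Omega>" using K by auto
  obtain d1 where d1: "0 < d1" "\<And>h. norm h < d1 \<Longrightarrow>
        f (x + h) \<le> f x + p \<bullet> h + (h \<bullet> B h) / 2 + \<kappa> * (norm h)\<^sup>2 \<and>
        g x + q \<bullet> h + (h \<bullet> B h) / 2 - \<kappa> * (norm h)\<^sup>2 \<le> g (x + h)"
    using expand[OF \<kappa>(1)] by blast
  obtain da where da: "0 < da" "ball a da \<subseteq> \<Omega>" using abK \<Omega>(2) open_contains_ball by blast
  obtain db where db: "0 < db" "ball b db \<subseteq> \<Omega>" using abK \<Omega>(2) open_contains_ball by blast
  define X where "X = (1 / 2) *\<^sub>R (matrix B + transpose (matrix B))"
  have X: "X \<in> symm_mats"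
    by (simp add: X_def symm_mats_def transpose_def vec_eq_iff add.commute)
  have XB: "h \<bullet> (X *v h) = h \<bullet> B h" for h
  proof -
    have "matrix B *v h = B h" using B by (simp add: matrix_works bounded_linear.linear)
    moreover have "h \<bullet> (transpose (matrix B) *v h) = h \<bullet> (matrix B *v h)"
      by (metis dot_lmul_matrix inner_commute transpose_matrix_vector)
    ultimately show ?thesis
      by (simp add: X_def scaleR_matrix_vector_assoc[symmetric] matrix_vector_mult_add_rdistrib inner_add_right)
  qed
  have XI: "h \<bullet> ((X + c *\<^sub>R mat 1) *v h) = h \<bullet> B h + c * (norm h)\<^sup>2" for h c
    by (simp add: matrix_vector_mult_add_rdistrib inner_add_right XB scaleR_matrix_vector_assoc[symmetric] power2_norm_eq_inner)
  have "(u a, X + (2 * \<kappa> - \<theta>) *\<^sub>R mat 1) \<in> jet_plus u a"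
  proof (rule jet_plus_quadraticI[where d = "min d1 da" and p = "p - \<theta> *\<^sub>R a"])
    fix h :: "real^'n" assume h: "norm h < min d1 da"
    have "a + h \<in> ball a da" using h by (simp add: dist_norm)
    then have "a + h \<in> S" using da(2) closure_subset unfolding S_def by blast
    from f_ge[OF this, of "x + h"] have "u' (a + h) - C * (norm (x - a))\<^sup>2 \<le> f (x + h)" by simp
    moreover have "f (x + h) \<le> f x + p \<bullet> h + (h \<bullet> B h) / 2 + \<kappa> * (norm h)\<^sup>2" using d1 h by simp
    moreover have "f x = u' a - C * (norm (x - a))\<^sup>2" by (simp add: f a_def)
    ultimately have "u' (a + h) \<le> u' a + p \<bullet> h + (h \<bullet> B h) / 2 + \<kappa> * (norm h)\<^sup>2" by linarith
    then show "u (a + h) \<le> u a + (p - \<theta> *\<^sub>R a) \<bullet> h + (h \<bullet> ((X + (2 * \<kappa> - \<theta>) *\<^sub>R mat 1) *v h)) / 2"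
      unfolding XI u'_def power2_norm_eq_inner by (simp add: inner_add_left inner_add_right inner_diff_left inner_diff_right inner_commute field_simps)
  qed (use X d1 da in auto)
  then have "(u a, X + (2 * \<kappa> - \<theta>) *\<^sub>R mat 1) \<in> \<Theta> a" using sub[OF abK(3)] by auto
  then have shifted: "(u a, X + (2 * \<kappa> - \<theta>) *\<^sub>R mat 1) + diag_shift \<kappa> \<in> \<Theta> b"
    using \<delta>(2)[OF abK(1,4)] dab \<rho> by auto
  have inv: "Q_invariant (\<Theta> b)" using \<Theta>(1) abK(4) by (rule proper_elliptic_map_Q_invariant)
  have jm: "(v b, X + (- (2 * \<kappa>)) *\<^sub>R mat 1) \<in> jet_minus v b"
  proof (rule jet_minus_quadraticI[where d = "min d1 db" and p = q])
    fix h :: "real^'n" assume h: "norm h < min d1 db"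
    have "b + h \<in> ball b db" using h by (simp add: dist_norm)
    then have "b + h \<in> S" using db(2) closure_subset unfolding S_def by blast
    from g'_ge[OF this, of "x + h"] have "g (x + h) \<le> v (b + h) + C * (norm (x - b))\<^sup>2" by (simp add: g_def)
    moreover have "g x + q \<bullet> h + (h \<bullet> B h) / 2 - \<kappa> * (norm h)\<^sup>2 \<le> g (x + h)" using d1 h by simp
    moreover have "g x = v b + C * (norm (x - b))\<^sup>2" by (simp add: g_def g' b_def)
    ultimately show "v b + q \<bullet> h + (h \<bullet> ((X + (- (2 * \<kappa>)) *\<^sub>R mat 1) *v h)) / 2 \<le> v (b + h)"
      unfolding XI by (simp add: field_simps)
  qed (use X d1 db symm_mats_simps(1)[OF X symm_mats_simps(3)[OF symm_mats_simps(4)]] in auto)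
  have "(v b + 2 * \<kappa> - u a, (\<theta> - 6 * \<kappa>) *\<^sub>R mat 1) \<in> Qcone"
    using ab u'_le[OF SS(1)] \<kappa> by (auto simp: Qcone_def intro!: psd_scaled_mat_1)
  with shifted inv have "((u a, X + (2 * \<kappa> - \<theta>) *\<^sub>R mat 1) + diag_shift \<kappa>) +
      (v b + 2 * \<kappa> - u a, (\<theta> - 6 * \<kappa>) *\<^sub>R mat 1) \<in> \<Theta> b"
    unfolding Q_invariant_def by blast
  moreover have "((u a, X + (2 * \<kappa> - \<theta>) *\<^sub>R mat 1) + diag_shift \<kappa>) +
      (v b + 2 * \<kappa> - u a, (\<theta> - 6 * \<kappa>) *\<^sub>R mat 1) = (v b, X + (- (2 * \<kappa>)) *\<^sub>R mat 1) - diag_shift \<kappa>"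
    by (simp add: diag_shift_def add.assoc scaleR_add_left[symmetric] scaleR_diff_left[symmetric] del: scaleR_minus_left)
  ultimately have "(v b, X + (- (2 * \<kappa>)) *\<^sub>R mat 1) - diag_shift \<kappa> \<in> \<Theta> b" by simp
  moreover have "(v b, X + (- (2 * \<kappa>)) *\<^sub>R mat 1) \<in> Jspace"
    using X by (simp add: Jspace_def)
  ultimately have "(v b, X + (- (2 * \<kappa>)) *\<^sub>R mat 1) \<in> int_J (\<Theta> b)"
    using int_J_iff_diag_shift[OF inv] \<kappa>(1) by blast
  with jm super[OF abK(4)] show False by blast
qed

theorem theorem6p13:
  fixes \<Omega> :: "(real^'n) set"
    and F :: "real^'n \<Rightarrow> real \<Rightarrow> real^'n^'n \<Rightarrow> real"
    and \<Phi> :: "real^'n \<Rightarrow> (real \<times> (real^'n^'n)) set"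
  defines "\<Theta> \<equiv> (\<lambda>x. {(r, A) \<in> \<Phi> x. F x r A \<ge> 0})"
    and "\<Gamma> \<equiv> (\<lambda>x. {(r, A) \<in> Jspace. F x r A = 0})"
  assumes \<Omega>: "bounded \<Omega>" "open \<Omega>" "connected \<Omega>"
    and F_cont: "continuous_on (\<Omega> \<times> UNIV \<times> symm_mats) (\<lambda>(x, r, A). F x r A)"
    and cases:
      "(proper_elliptic_map \<Omega> \<Phi> \<and> hausdorff_continuous \<Omega> \<Phi> \<and>
          (\<forall>x\<in>\<Omega>. bdry_J (\<Phi> x) \<subseteq> {(r, A). F x r A \<le> 0}))
       \<or> ((\<forall>x\<in>\<Omega>. \<Phi> x = Jspace) \<and>
          (\<forall>x\<in>\<Omega>. {(r, A) \<in> Jspace. F x r A < 0} \<noteq> {}))"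
    and mono: "\<forall>x\<in>\<Omega>. \<forall>(r, A)\<in>\<Phi> x. \<forall>(s, P)\<in>Qcone. F x (r + s) (A + P) \<ge> F x r A"
    and unif: "\<forall>\<Omega>'. open \<Omega>' \<and> bounded \<Omega>' \<and> closure \<Omega>' \<subseteq> \<Omega> \<longrightarrow>
                 (\<forall>\<eta>>0. \<exists>\<delta>>0. \<forall>x\<in>\<Omega>'. \<forall>y\<in>\<Omega>'. dist x y < \<delta> \<longrightarrow>
                    (\<forall>(r, A)\<in>\<Phi> x. F y (r - \<eta>) (A + \<eta> *\<^sub>R mat 1) \<ge> F x r A))"
    and nonempty: "\<forall>x\<in>\<Omega>. \<Gamma> x \<inter> \<Phi> x \<noteq> {}"
    and pos_int: "\<forall>x\<in>\<Omega>. \<forall>(r, A)\<in>int_J (\<Theta> x). F x r A > 0"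
  shows "proper_elliptic_map \<Omega> \<Theta> \<and> hausdorff_continuous \<Omega> \<Theta> \<and>
         (\<forall>x\<in>\<Omega>. bdry_J (\<Theta> x) \<subseteq> \<Gamma> x) \<and>
         (\<forall>u v. usc_on (closure \<Omega>) u \<and> lsc_on (closure \<Omega>) v \<and>
                adm_subsolution F \<Phi> \<Omega> u \<and> adm_supersolution F \<Phi> \<Omega> v \<and>
                (\<forall>x\<in>frontier \<Omega>. u x \<le> v x)
                \<longrightarrow> (\<forall>x\<in>\<Omega>. u x \<le> v x))"
proof -
  have \<Theta>_iff: "p \<in> \<Theta> x \<longleftrightarrow> p \<in> \<Phi> x \<and> 0 \<le> F x (fst p) (snd p)" for p x
    by (auto simp: \<Theta>_def)
  have \<Theta>\<Phi>: "\<Theta> x \<subseteq> \<Phi> x" for x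
    by (auto simp: \<Theta>_def)
  have inv\<Phi>: "Q_invariant (\<Phi> x)" if "x \<in> \<Omega>" for x
    using cases
  proof
    assume "(\<forall>x\<in>\<Omega>. \<Phi> x = Jspace) \<and> (\<forall>x\<in>\<Omega>. {(r, A) \<in> Jspace. F x r A < 0} \<noteq> {})"
    then show ?thesis using that Q_invariant_Jspace by simp
  qed (use that proper_elliptic_map_Q_invariant in blast)
  have closed\<Phi>: "closure_J (\<Phi> x) \<subseteq> \<Phi> x" if "x \<in> \<Omega>" for x
    using cases that by (auto simp: proper_elliptic_map_def closed_J_def closure_J_def)
  have shift\<Phi>: "\<exists>\<delta>>0. \<forall>y\<in>\<Omega>. dist x y < \<delta> \<longrightarrow>
      (\<forall>p\<in>\<Phi> x. p + diag_shift \<eta> \<in> \<Phi> y) \<and> (\<forall>p\<in>\<Phi> y. p + diag_shift \<eta> \<in> \<Phi> x)"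
    if x: "x \<in> \<Omega>" and \<eta>: "0 < \<eta>" for x \<eta>
    using cases
  proof
    assume "proper_elliptic_map \<Omega> \<Phi> \<and> hausdorff_continuous \<Omega> \<Phi> \<and>
        (\<forall>x\<in>\<Omega>. bdry_J (\<Phi> x) \<subseteq> {(r, A). F x r A \<le> 0})"
    then obtain \<delta> where \<delta>: "0 < \<delta>" "\<And>y. y \<in> \<Omega> \<Longrightarrow> dist x y < \<delta> \<Longrightarrow> hdist_J (\<Phi> x) (\<Phi> y) < ereal \<eta>"
      using x \<eta> unfolding hausdorff_continuous_def by metis
    have "(\<forall>p\<in>\<Phi> x. p + diag_shift \<eta> \<in> \<Phi> y) \<and> (\<forall>p\<in>\<Phi> y. p + diag_shift \<eta> \<in> \<Phi> x)"
      if y: "y \<in> \<Omega>" "dist x y < \<delta>" for y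
    proof -
      have J: "\<Phi> x \<subseteq> Jspace" "\<Phi> y \<subseteq> Jspace" using inv\<Phi> x y by (auto simp: Q_invariant_def)
      have h: "hdist_J (\<Phi> x) (\<Phi> y) < ereal \<eta>" "hdist_J (\<Phi> y) (\<Phi> x) < ereal \<eta>"
        using \<delta>(2)[OF y] by (auto simp: hdist_J_commute)
      show ?thesis
        using diag_shift_if_hdist_less[OF inv\<Phi>[OF y(1)] J(1) h(1)]
          diag_shift_if_hdist_less[OF inv\<Phi>[OF x] J(2) h(2)] by blast
    qed
    with \<delta>(1) show ?thesis by blast
  next
    assume "(\<forall>x\<in>\<Omega>. \<Phi> x = Jspace) \<and> (\<forall>x\<in>\<Omega>. {(r, A) \<in> Jspace. F x r A < 0} \<noteq> {})"
    then show ?thesis using x by (intro exI[of _ 1]) auto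
  qed
  have F_diag: "((\<lambda>e. F x (fst (p + diag_shift e)) (snd (p + diag_shift e))) \<longlongrightarrow> F x (fst p) (snd p)) (at 0)"
    if x: "x \<in> \<Omega>" and p: "p \<in> Jspace" for x p
  proof -
    let ?c = "\<lambda>e. (x, fst p - e, snd p + e *\<^sub>R mat 1) :: _ \<times> real \<times> (real^'n^'n)"
    have "continuous_on UNIV ?c" by (intro continuous_intros)
    moreover have "?c ` UNIV \<subseteq> \<Omega> \<times> UNIV \<times> symm_mats"
      using x p by (auto simp: Jspace_def)
    ultimately have "continuous_on UNIV (\<lambda>e. (\<lambda>(x, r, A). F x r A) (?c e))"
      by (intro continuous_on_compose2[OF F_cont]) auto
    then have "((\<lambda>e. (\<lambda>(x, r, A). F x r A) (?c e)) \<longlongrightarrow> (\<lambda>(x, r, A). F x r A) (?c 0)) (at 0)"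
      by (simp only: continuous_on_def UNIV_I ball_UNIV)
    then show ?thesis by (simp add: diag_shift_def case_prod_beta)
  qed
  have inv\<Theta>: "Q_invariant (\<Theta> x)" if x: "x \<in> \<Omega>" for x
    unfolding Q_invariant_def
  proof (intro conjI ballI)
    show "\<Theta> x \<subseteq> Jspace" using inv\<Phi>[OF x] by (auto simp: \<Theta>_iff Q_invariant_def)
    fix p q :: "real \<times> (real^'n^'n)" assume p: "p \<in> \<Theta> x" and q: "q \<in> Qcone"
    have "F x (fst p) (snd p) \<le> F x (fst p + fst q) (snd p + snd q)"
      using mono[rule_format, OF x, of p] p q by (auto simp: \<Theta>_iff case_prod_beta)
    then show "p + q \<in> \<Theta> x" using p q inv\<Phi>[OF x] by (auto simp: \<Theta>_iff Q_invariant_def)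
  qed
  have closed\<Theta>: "closure_J (\<Theta> x) \<subseteq> \<Theta> x" if x: "x \<in> \<Omega>" for x
  proof
    fix p assume p: "p \<in> closure_J (\<Theta> x)"
    have pJ: "p \<in> Jspace" using p by (simp add: closure_J_def)
    have "p \<in> closure_J (\<Phi> x)" using p closure_J_mono[OF \<Theta>\<Phi>] by blast
    then have "p \<in> \<Phi> x" using closed\<Phi>[OF x] by auto
    moreover have "0 \<le> F x (fst p) (snd p)"
    proof (rule tendsto_lowerbound)
      show "((\<lambda>e. F x (fst (p + diag_shift e)) (snd (p + diag_shift e))) \<longlongrightarrow> F x (fst p) (snd p)) (at_right 0)"
        using F_diag[OF x pJ] by (rule tendsto_mono[OF at_le, rotated]) simp
      have "0 \<le> F x (fst (p + diag_shift e)) (snd (p + diag_shift e))" if e: "0 < e" for e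
      proof -
        obtain q where q: "q \<in> \<Theta> x" "jnorm (q - p) < e" using p e unfolding closure_J_def by blast
        then have "p + diag_shift e \<in> \<Theta> x"
          using pJ by (intro Q_invariant_near[OF inv\<Theta>[OF x] q(1)]) (auto simp: jnorm_commute[of p])
        then show ?thesis by (simp only: \<Theta>_iff)
      qed
      then show "\<forall>\<^sub>F e in at_right 0. 0 \<le> F x (fst (p + diag_shift e)) (snd (p + diag_shift e))"
        by (intro eventually_at_rightI[of 0 1]) auto
    qed simp
    ultimately show "p \<in> \<Theta> x" by (simp add: \<Theta>_iff)
  qed
  have ne: "\<Theta> x \<noteq> {}" if "x \<in> \<Omega>" for x
    using nonempty that by (force simp: \<Theta>_def \<Gamma>_def)
  have proper: "\<Theta> x \<noteq> Jspace" if x: "x \<in> \<Omega>" for x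
    using cases
  proof
    assume "proper_elliptic_map \<Omega> \<Phi> \<and> hausdorff_continuous \<Omega> \<Phi> \<and>
        (\<forall>x\<in>\<Omega>. bdry_J (\<Phi> x) \<subseteq> {(r, A). F x r A \<le> 0})"
    then have "\<Phi> x \<noteq> Jspace" using x by (simp add: proper_elliptic_map_def)
    then show ?thesis using inv\<Phi>[OF x] \<Theta>_iff[of _ x] by (auto simp: Q_invariant_def)
  next
    assume "(\<forall>x\<in>\<Omega>. \<Phi> x = Jspace) \<and> (\<forall>x\<in>\<Omega>. {(r, A) \<in> Jspace. F x r A < 0} \<noteq> {})"
    then obtain p where "p \<in> Jspace" "F x (fst p) (snd p) < 0" using x by fastforce
    then show ?thesis using \<Theta>_iff[of p x] by auto
  qed
  have elliptic: "proper_elliptic_map \<Omega> \<Theta>"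
    unfolding proper_elliptic_map_def closed_J_def
    using inv\<Theta> closed\<Theta> ne proper by (auto simp: Q_invariant_def)
  have hausdorff: "hausdorff_continuous \<Omega> \<Theta>"
    unfolding hausdorff_continuous_def
  proof (intro ballI allI impI)
    fix x and \<eta> :: real assume x: "x \<in> \<Omega>" and "0 < \<eta>"
    then have \<eta>: "0 < \<eta> / 2" by simp
    obtain r where r: "0 < r" "cball x r \<subseteq> \<Omega>" using x \<Omega>(2) open_contains_cball by blast
    have "open (ball x r) \<and> bounded (ball x r) \<and> closure (ball x r) \<subseteq> \<Omega>" using r by simp
    then obtain \<delta>1 where \<delta>1: "0 < \<delta>1" "\<forall>y\<in>ball x r. \<forall>z\<in>ball x r. dist y z < \<delta>1 \<longrightarrow>
        (\<forall>(r, A)\<in>\<Phi> y. F z (r - \<eta> / 2) (A + (\<eta> / 2) *\<^sub>R mat 1) \<ge> F y r A)"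
      using unif \<eta> by meson
    obtain \<delta>2 where \<delta>2: "0 < \<delta>2" "\<And>y. y \<in> \<Omega> \<Longrightarrow> dist x y < \<delta>2 \<Longrightarrow>
        (\<forall>p\<in>\<Phi> x. p + diag_shift (\<eta> / 2) \<in> \<Phi> y) \<and> (\<forall>p\<in>\<Phi> y. p + diag_shift (\<eta> / 2) \<in> \<Phi> x)"
      using shift\<Phi>[OF x \<eta>] by blast
    have step: "p + diag_shift (\<eta> / 2) \<in> \<Theta> z"
      if "y \<in> ball x r" "z \<in> ball x r" "dist y z < \<delta>1" "p \<in> \<Theta> y" "p + diag_shift (\<eta> / 2) \<in> \<Phi> z" for y z p
    proof -
      have "F y (fst p) (snd p) \<le> F z (fst p - \<eta> / 2) (snd p + (\<eta> / 2) *\<^sub>R mat 1)"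
        using \<delta>1(2)[rule_format, OF that(1-3), of p] that(4) by (simp add: \<Theta>_iff case_prod_beta)
      with that(4,5) show ?thesis by (simp add: \<Theta>_iff diag_shift_def)
    qed
    have "hdist_J (\<Theta> x) (\<Theta> y) < ereal \<eta>" if y: "y \<in> \<Omega>" "dist x y < min r (min \<delta>1 \<delta>2)" for y
    proof -
      have "hdist_J (\<Theta> x) (\<Theta> y) \<le> ereal (\<eta> / 2)"
      proof (rule hdist_le_if_diag_shift)
        show "p + diag_shift (\<eta> / 2) \<in> \<Theta> y" if "p \<in> \<Theta> x" for p
          by (rule step[of x]) (use that y r \<delta>2(2)[OF y(1)] in \<open>auto simp: \<Theta>_iff\<close>)
        show "p + diag_shift (\<eta> / 2) \<in> \<Theta> x" if "p \<in> \<Theta> y" for p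
          by (rule step[of y]) (use that y r \<delta>2(2)[OF y(1)] in \<open>auto simp: \<Theta>_iff dist_commute\<close>)
      qed (use \<eta> in simp)
      also have "\<dots> < ereal \<eta>" using \<open>0 < \<eta>\<close> by simp
      finally show ?thesis .
    qed
    with r \<delta>1 \<delta>2 show "\<exists>\<delta>>0. \<forall>y\<in>\<Omega>. dist x y < \<delta> \<longrightarrow> hdist_J (\<Theta> x) (\<Theta> y) < ereal \<eta>"
      by (intro exI[of _ "min r (min \<delta>1 \<delta>2)"]) auto
  qed
  have bdry: "bdry_J (\<Theta> x) \<subseteq> \<Gamma> x" if x: "x \<in> \<Omega>" for x
  proof
    fix p assume "p \<in> bdry_J (\<Theta> x)"
    then have p: "p \<in> \<Theta> x" "p \<notin> int_J (\<Theta> x)" using closed\<Theta>[OF x] by (auto simp: bdry_J_def)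
    then have pJ: "p \<in> Jspace" using inv\<Theta>[OF x] by (auto simp: Q_invariant_def)
    have p\<Phi>: "p \<in> \<Phi> x" and F0: "0 \<le> F x (fst p) (snd p)" using p by (auto simp: \<Theta>_iff)
    have "\<not> 0 < F x (fst p) (snd p)"
    proof
      assume pos: "0 < F x (fst p) (snd p)"
      have "p \<in> int_J (\<Phi> x)"
        using cases
      proof
        assume *: "proper_elliptic_map \<Omega> \<Phi> \<and> hausdorff_continuous \<Omega> \<Phi> \<and>
            (\<forall>x\<in>\<Omega>. bdry_J (\<Phi> x) \<subseteq> {(r, A). F x r A \<le> 0})"
        have "p \<notin> bdry_J (\<Phi> x)"
        proof
          assume "p \<in> bdry_J (\<Phi> x)"
          with * x have "p \<in> {(r, A). F x r A \<le> 0}" by blast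
          with pos show False by auto
        qed
        moreover have "p \<in> closure_J (\<Phi> x)"
          using subset_closure_J[of "\<Phi> x"] inv\<Phi>[OF x] p\<Phi> by (auto simp: Q_invariant_def)
        ultimately show ?thesis by (simp add: bdry_J_def)
      next
        assume "(\<forall>x\<in>\<Omega>. \<Phi> x = Jspace) \<and> (\<forall>x\<in>\<Omega>. {(r, A) \<in> Jspace. F x r A < 0} \<noteq> {})"
        then show ?thesis using x p\<Phi> by (auto simp: int_J_def intro!: exI[of _ 1])
      qed
      then obtain e where e: "0 < e" "p - diag_shift e \<in> \<Phi> x"
        using int_J_iff_diag_shift[OF inv\<Phi>[OF x] pJ] by blast
      have "\<forall>\<^sub>F s in at 0. 0 < F x (fst (p + diag_shift s)) (snd (p + diag_shift s))"
        using order_tendstoD(1)[OF F_diag[OF x pJ] pos] .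
      then obtain d where d: "0 < d" "\<And>s. s \<noteq> 0 \<Longrightarrow> \<bar>s\<bar> < d \<Longrightarrow>
          0 < F x (fst (p + diag_shift s)) (snd (p + diag_shift s))"
        unfolding eventually_at by (auto simp: dist_real_def)
      define s where "s = min e (d / 2)"
      have s: "0 < s" "s \<le> e" "s < d" using e d by (auto simp: s_def)
      have neg: "p - diag_shift s = p + diag_shift (- s)" by (simp add: diag_shift_def prod_eq_iff)
      have "p - diag_shift e + diag_shift (e - s) \<in> \<Phi> x"
        using inv\<Phi>[OF x] e diag_shift_Qcone[of "e - s"] s unfolding Q_invariant_def by auto
      moreover have "p - diag_shift e + diag_shift (e - s) = p - diag_shift s"
        by (simp add: diag_shift_def prod_eq_iff scaleR_diff_left)
      moreover have "0 < F x (fst (p - diag_shift s)) (snd (p - diag_shift s))"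
        unfolding neg using d(2)[of "- s"] s by simp
      ultimately have "p - diag_shift s \<in> \<Theta> x" by (simp add: \<Theta>_iff)
      then have "p \<in> int_J (\<Theta> x)"
        using int_J_iff_diag_shift[OF inv\<Theta>[OF x] pJ] s(1) by blast
      with p show False by blast
    qed
    with F0 pJ show "p \<in> \<Gamma> x" by (auto simp: \<Gamma>_def)
  qed
  have "u x0 \<le> v x0"
    if u: "usc_on (closure \<Omega>) u" and v: "lsc_on (closure \<Omega>) v"
      and sub: "adm_subsolution F \<Phi> \<Omega> u" and super: "adm_supersolution F \<Phi> \<Omega> v"
      and bd: "\<forall>x\<in>frontier \<Omega>. u x \<le> v x" and x0: "x0 \<in> \<Omega>" for u v x0
  proof (rule comparison_elliptic_map[OF \<Omega>(1,2) elliptic hausdorff u v _ _ _ x0])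
    show "jet_plus u x \<subseteq> \<Theta> x" if "x \<in> \<Omega>" for x
      using sub that by (fastforce simp: adm_subsolution_def \<Theta>_iff)
    show "jet_minus v x \<inter> int_J (\<Theta> x) = {}" if x: "x \<in> \<Omega>" for x
    proof -
      have False if p: "p \<in> jet_minus v x" "p \<in> int_J (\<Theta> x)" for p
      proof -
        have "0 < F x (fst p) (snd p)" using pos_int x p(2) by (auto simp: case_prod_beta)
        moreover have "p \<in> int_J (\<Phi> x)"
          using int_J_mono[OF \<Theta>\<Phi>] p(2) by blast
        ultimately show False
          using super x p(1) by (force simp: adm_supersolution_def case_prod_beta)
      qed
      then show ?thesis by blast
    qed
  qed (use bd in auto)
  with elliptic hausdorff bdry show ?thesis by blast
qed

end
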